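(* If the refinable function $\varphi$ belongs to $C(\mathbb{R}^s)$, then $$\alpha_{\varphi,J_i}\;=\;\log_{1/r_i}\rho_i,\qquad i=1,\ldots,q(M).$$
   Context: Setting. $M\in\mathbb{Z}^{s\times s}$ is an expansive integer matrix (all its eigenvalues are larger than $1$ in absolute value), $m=|\det M|\ge 2$. $D(M)=\{d_0,\ldots,d_{m-1}\}\subset\mathbb{Z}^s$ is a complete set of representatives of $\mathbb{Z}^s/M\mathbb{Z}^s$ with $0\in D(M)$. $G=\{\sum_{i\ge1}M^{-i}d_i : d_i\in D(M)\}$ is assumed to be a tile, i.e. $\mu(G)=1$ (Lebesgue measure), so the sets $k+G$, $k\in\mathbb{Z}^s$, cover $\mathbb{R}^s$ with overlaps of measure zero. $c=(c_k)_{k\in\mathbb{Z}^s}$ is a finitely supported real sequence with $\sum_{k\in\mathbb{Z}^s}c_{Mk-d}=1$ for all $d\in D(M)$. The refinable function $\varphi$ is the compactly supported distribution on $\mathbb{R}^s$ with $\varphi(x)=\sum_{k\in\mathbb{Z}^s}c_k\,\varphi(Mx-k)$ and $\int\varphi=1$. Let $K=\{\sum_{j\ge1}M^{-j}\gamma_j:\gamma_j\in\mathrm{supp}(c)\}$ (then $\mathrm{supp}\,\varphi\subseteq K$), $\Omega\subset\mathbb{Z}^s$ a finite minimal set with $K\subseteq\Omega+G$, $N=|\Omega|$. The transition matrices are $(T_d)_{ab}=c_{Ma-b+d}$, $a,b\in\Omega$, $d\in D(M)$. For continuous $\varphi$, $v:G\to\mathbb{R}^N$, $v(x)=(\varphi(x+k))_{k\in\Omega}$.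 Let $r_1,\ldots,r_{q(M)}$ be the distinct moduli of the eigenvalues of $M$, and let $J_i\subseteq\mathbb{R}^s$ be the $M$-invariant (spectral) subspace corresponding to all the eigenvalues of modulus $r_i$, so that $\mathbb{R}^s=\bigoplus_iJ_i$. Let $U_i=\mathrm{span}\{v(y)-v(x): x,y\in G,\ y-x\in J_i\}$, which is invariant under all $T_d$, and let $\rho_i$ be the joint spectral radius of the family $\{T_d|_{U_i}\}_{d\in D(M)}$. The joint spectral radius of a finite family $\mathcal{A}$ is $\rho(\mathcal{A})=\lim_{k\to\infty}\max_{A_{d_j}\in\mathcal{A}}\|A_{d_1}\cdots A_{d_k}\|^{1/k}$. The Hölder exponent of $\varphi$ along a linear subspace $J\subset\mathbb{R}^s$ is $\alpha_{\varphi,J}=\sup\{\alpha\ge0:\exists C\ \ |\varphi(y)-\varphi(x)|\le C\|y-x\|^\alpha\text{ for all }x,y\text{ with }y-x\in J\}$. Here $\log_{1/r}\rho=-\ln\rho/\ln r$. *)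

theory Defs
  imports "HOL-Analysis.Analysis" "HOL-Library.Extended_Real"
begin

definition rvec :: "int ^ 's \<Rightarrow> real ^ 's"
  where "rvec k = (\<chi> i. real_of_int (k $ i))"

definition cvec :: "real ^ 's \<Rightarrow> complex ^ 's"
  where "cvec x = (\<chi> i. complex_of_real (x $ i))"

definition rmat :: "int ^ 's ^ 's \<Rightarrow> real ^ 's ^ 's"
  where "rmat M = map_matrix real_of_int M"

definition cmat :: "int ^ 's ^ 's \<Rightarrow> complex ^ 's ^ 's"
  where "cmat M = map_matrix complex_of_int M"

definition eigenvalues :: "complex ^ 's ^ 's \<Rightarrow> complex set"
  where "eigenvalues A = {l. \<exists>z. z \<noteq> 0 \<and> A *v z = l *s z}"

definition gen_eigenspace :: "complex ^ 's ^ 's \<Rightarrow> complex \<Rightarrow> (complex ^ 's) set"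
  where "gen_eigenspace A l = {z. \<exists>n. ((\<lambda>w. A *v w - l *s w) ^^ n) z = 0}"

definition expansive :: "int ^ 's ^ 's \<Rightarrow> bool"
  where "expansive M \<longleftrightarrow> (\<forall>l \<in> eigenvalues (cmat M). 1 < cmod l)"

definition eigenvalue_moduli :: "int ^ 's ^ 's \<Rightarrow> real set"
  where "eigenvalue_moduli M = cmod ` eigenvalues (cmat M)"

text \<open>
  The real spectral subspace of all eigenvalues of modulus r: the real points of the complex span
  of the corresponding generalized eigenspaces (\<open>vec.span\<close> is the span over the
  scalar field of the vectors, here the complex numbers).
\<close>
definition spectral_subspace :: "int ^ 's ^ 's \<Rightarrow> real \<Rightarrow> (real ^ 's) set"
  where "spectral_subspace M r =
    {x. cvec x \<in> vec.span (\<Union>l \<in> {l \<in> eigenvalues (cmat M). cmod l = r}. gen_eigenspace (cmat M) l)}"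

definition complete_digit_set :: "int ^ 's ^ 's \<Rightarrow> (int ^ 's) set \<Rightarrow> bool"
  where "complete_digit_set M D \<longleftrightarrow> (\<forall>k. \<exists>!d. d \<in> D \<and> (\<exists>j. k - d = M *v j))"

text \<open>
  All sums of the series of \<open>M\<^sup>-\<^sup>j \<gamma>\<^sub>j\<close>, j \<open>\<ge>\<close> 1, with digits from S. The inverse is iterated
  as a linear map, because \<open>^\<close> on the vector type is the componentwise power.
\<close>
definition radix_set :: "int ^ 's ^ 's \<Rightarrow> (int ^ 's) set \<Rightarrow> (real ^ 's) set"
  where "radix_set M S =
    {x. \<exists>\<gamma> :: nat \<Rightarrow> int ^ 's. (\<forall>j. \<gamma> j \<in> S) \<and>
        (\<lambda>j. (((*v) (matrix_inv (rmat M))) ^^ Suc j) (rvec (\<gamma> j))) sums x}"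

definition coeff_support :: "(int ^ 's \<Rightarrow> real) \<Rightarrow> (int ^ 's) set"
  where "coeff_support c = {k. c k \<noteq> 0}"

definition sum_rules :: "int ^ 's ^ 's \<Rightarrow> (int ^ 's) set \<Rightarrow> (int ^ 's \<Rightarrow> real) \<Rightarrow> bool"
  where "sum_rules M D c \<longleftrightarrow>
    (\<forall>d \<in> D. (\<Sum>k | c (M *v k - d) \<noteq> 0. c (M *v k - d)) = 1)"

text \<open>
  A continuous refinable function. For continuous \<open>\<phi>\<close> the refinement equation between
  distributions is the pointwise one, and the distributional support is the closure of the set
  where \<open>\<phi>\<close> does not vanish.
\<close>
definition continuous_refinable ::
    "int ^ 's ^ 's \<Rightarrow> (int ^ 's \<Rightarrow> real) \<Rightarrow> (real ^ 's \<Rightarrow> real) \<Rightarrow> bool"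
  where "continuous_refinable M c \<phi> \<longleftrightarrow>
    continuous_on UNIV \<phi> \<and>
    compact (closure {x. \<phi> x \<noteq> 0}) \<and>
    (\<forall>x. \<phi> x = (\<Sum>k \<in> coeff_support c. c k * \<phi> (rmat M *v x - rvec k))) \<and>
    (LINT x|lborel. \<phi> x) = 1"

definition translates :: "(int ^ 's) set \<Rightarrow> (real ^ 's) set \<Rightarrow> (real ^ 's) set"
  where "translates \<Omega> G = {rvec k + g | k g. k \<in> \<Omega> \<and> g \<in> G}"

definition minimal_cover :: "(real ^ 's) set \<Rightarrow> (real ^ 's) set \<Rightarrow> (int ^ 's) set \<Rightarrow> bool"
  where "minimal_cover K G \<Omega> \<longleftrightarrow>
    finite \<Omega> \<and> K \<subseteq> translates \<Omega> G \<and> (\<forall>\<Omega>'. \<Omega>' \<subset> \<Omega> \<longrightarrow> \<not> K \<subseteq> translates \<Omega>' G)"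

text \<open>
  The index set \<open>\<Omega>\<close> of size N is enumerated by an injection \<open>\<omega>\<close> of a finite type \<open>'n\<close> with N elements;
  vectors and matrices indexed by \<open>\<Omega>\<close> are vectors and matrices over \<open>'n\<close>.
\<close>
definition transition_matrix ::
    "int ^ 's ^ 's \<Rightarrow> (int ^ 's \<Rightarrow> real) \<Rightarrow> ('n \<Rightarrow> int ^ 's) \<Rightarrow> int ^ 's \<Rightarrow> real ^ 'n ^ 'n"
  where "transition_matrix M c \<omega> d = (\<chi> a b. c (M *v \<omega> a - \<omega> b + d))"

definition shift_vector :: "(real ^ 's \<Rightarrow> real) \<Rightarrow> ('n \<Rightarrow> int ^ 's) \<Rightarrow> real ^ 's \<Rightarrow> real ^ 'n"
  where "shift_vector \<phi> \<omega> x = (\<chi> a. \<phi> (x + rvec (\<omega> a)))"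

definition difference_space ::
    "(real ^ 's \<Rightarrow> real ^ 'n) \<Rightarrow> (real ^ 's) set \<Rightarrow> (real ^ 's) set \<Rightarrow> (real ^ 'n) set"
  where "difference_space v G J = span {v y - v x | x y. x \<in> G \<and> y \<in> G \<and> y - x \<in> J}"

text \<open>Operator norm of the restriction of A to the subspace U, as \<open>onorm\<close> on the whole space.\<close>
definition onorm_on :: "(real ^ 'n) set \<Rightarrow> real ^ 'n ^ 'n \<Rightarrow> real"
  where "onorm_on U A = (SUP u \<in> U. norm (A *v u) / norm u)"

definition matrix_word :: "(real ^ 'n ^ 'n) list \<Rightarrow> real ^ 'n ^ 'n"
  where "matrix_word As = foldr (**) As (mat 1)"

text \<open>
  Joint spectral radius of the restrictions to U of the matrices of a finite family, which are
  meant to leave U invariant.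
\<close>
definition joint_spectral_radius_on :: "(real ^ 'n) set \<Rightarrow> (real ^ 'n ^ 'n) set \<Rightarrow> real"
  where "joint_spectral_radius_on U \<A> =
    lim (\<lambda>k. root k (Max {onorm_on U (matrix_word As) | As. set As \<subseteq> \<A> \<and> length As = k}))"

definition holder_exponent :: "(real ^ 's \<Rightarrow> real) \<Rightarrow> (real ^ 's) set \<Rightarrow> ereal"
  where "holder_exponent \<phi> J =
    (SUP \<alpha> \<in> {\<alpha>. 0 \<le> \<alpha> \<and> (\<exists>C. \<forall>x y. y - x \<in> J \<longrightarrow> \<bar>\<phi> y - \<phi> x\<bar> \<le> C * norm (y - x) powr \<alpha>)}. ereal \<alpha>)"

end

theory Submission
  imports Defs "HOL-Computational_Algebra.Fundamental_Theorem_Algebra"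
begin

text \<open>
  Write \<open>B\<close> for the inverse of \<open>M\<close>, \<open>J\<close> for the spectral subspace of the modulus \<open>r\<close>, \<open>v\<close> for the
  vector of translates of \<open>\<phi>\<close> on the tile \<open>G\<close>, \<open>U\<close> for the span of its differences along \<open>J\<close>, and \<open>\<rho>\<close>
  for the joint spectral radius on \<open>U\<close>.

  On the tile the refinement equation is the self-similarity \<open>v (B (y + d)) = T\<^sub>d (v y)\<close> (lemma
  \<open>transition\<close>). So a word of \<open>k\<close> transition matrices, applied to a difference of \<open>v\<close> over \<open>G\<close>, gives
  the difference of \<open>v\<close> over a piece of \<open>G\<close> shrunk by \<open>B\<^sup>k\<close>; and on \<open>J\<close> the map \<open>B\<^sup>k\<close> shrinks by
  \<open>r\<^sup>-\<^sup>k\<close> and \<open>M\<^sup>k\<close> stretches by \<open>r\<^sup>k\<close>, both up to subexponential factors. The equality is the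
  comparison of these two rates.

  If \<open>\<phi>\<close> is Hoelder along \<open>J\<close> with exponent \<open>\<alpha>\<close>, then words of length \<open>k\<close> map each generator of \<open>U\<close>
  to a vector of size about \<open>r\<^sup>-\<^sup>k\<^sup>\<alpha>\<close>. In finite dimension this holds uniformly on the unit ball of
  \<open>U\<close>, hence \<open>\<rho> \<le> r\<^sup>-\<^sup>\<alpha>\<close> (\<open>jsr_le_of_holder\<close>).

  Conversely let \<open>\<rho> < l\<close>. Then \<open>\<phi>\<close> varies along \<open>J\<close> by \<open>O(l\<^sup>k)\<close> inside each translate of \<open>G\<close>
  contracted by \<open>B\<^sup>k\<close>. A segment in direction \<open>J\<close> whose image under \<open>M\<^sup>k\<close> has length at most 1 meets a
  bounded number of these pieces. Its image under \<open>\<phi>\<close> is an interval, because \<open>\<phi>\<close> is continuous, and it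
  is covered by boundedly many intervals of length \<open>O(l\<^sup>k)\<close>; so the increment of \<open>\<phi>\<close> is \<open>O(l\<^sup>k)\<close>
  (\<open>dilated_increment_bound\<close>). Choosing \<open>k\<close> just before the image of the segment exceeds length 1 turns this
  into a Hoelder estimate (\<open>holder_of_jsr_less\<close>).

  The logarithm is meaningful because \<open>\<rho> > 0\<close>: otherwise \<open>\<phi>\<close> would be Hoelder with exponent 2 along
  \<open>J \<noteq> 0\<close>, hence constant along \<open>J\<close>, hence zero by compactness of its support, against \<open>\<integral>\<phi> = 1\<close>
  (\<open>not_holder_2\<close>).

  That finitely many translates suffice in \<open>v\<close> depends on \<open>\<mu>(G) = 1\<close>: the integer translates of \<open>G\<close> then
  overlap only in null sets, so a translate outside \<open>\<Omega>\<close> cannot meet the open set where \<open>\<phi> \<noteq> 0\<close>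
  (\<open>\<phi>_vanishes\<close>).
\<close>

section \<open>Growth of the powers of a complex matrix\<close>

lemma norm_vec_scalar_mult: "norm (c *s (z :: complex ^ 'n)) = cmod c * norm z"
  by (simp add: norm_vec_def L2_set_def norm_mult power_mult_distrib real_sqrt_mult
      flip: sum_distrib_left)

text \<open>
  A recursion of rate \<open>q\<close> follows a perturbation of a larger rate \<open>R\<close> without resonance, so its solution
  has rate \<open>R\<close> and no polynomial factor appears. This is what makes a Jordan block of any size grow no
  faster than its eigenvalue, up to an arbitrarily small loss in the rate.
\<close>
lemma geometric_recursion_bound:
  fixes b :: "nat \<Rightarrow> real"
  assumes "0 \<le> q" "q < R" "0 \<le> C" and step: "\<And>k. b (Suc k) \<le> q * b k + C * R ^ k"
  shows "\<exists>C'. \<forall>k. b k \<le> C' * R ^ k"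
proof (intro exI allI)
  \<comment> \<open>the first entry starts the induction, the second absorbs the perturbation\<close>
  define C' where "C' = max (b 0) (C / (R - q))"
  have C': "C \<le> (R - q) * C'"
    using assms(2) by (simp add: C'_def field_simps max_def split: if_splits)
  show "b k \<le> C' * R ^ k" for k
  proof (induction k)
    case 0
    show ?case by (simp add: C'_def)
  next
    case (Suc k)
    have "b (Suc k) \<le> q * (C' * R ^ k) + C * R ^ k"
      using step[of k] mult_left_mono[OF Suc assms(1)] by linarith
    also have "\<dots> \<le> q * (C' * R ^ k) + (R - q) * C' * R ^ k"
      using mult_right_mono[OF C', of "R ^ k"] assms(1,2) by simp
    also have "\<dots> = C' * R ^ Suc k" by (simp add: algebra_simps)
    finally show ?case .
  qed
qed

definition shift_map :: "complex ^ 'n ^ 'n \<Rightarrow> complex \<Rightarrow> complex ^ 'n \<Rightarrow> complex ^ 'n"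
  where "shift_map A l z = A *v z - l *s z"

lemma shift_map_simps:
  "shift_map A l 0 = 0"
  "shift_map A l (y + z) = shift_map A l y + shift_map A l z"
  "shift_map A l (y - z) = shift_map A l y - shift_map A l z"
  "shift_map A l (c *s z) = c *s shift_map A l z"
  "shift_map A l (A *v z) = A *v shift_map A l z"
  by (simp_all add: shift_map_def matrix_vector_right_distrib matrix_vector_mult_diff_distrib
      vector_scalar_commute vector_add_ldistrib vector_ssub_ldistrib algebra_simps
      vector_smult_assoc mult.commute)

lemma fold_shift_map_commute:
  "fold (shift_map A) ls (shift_map A l z) = shift_map A l (fold (shift_map A) ls z)"
proof (induction ls arbitrary: z)
  case (Cons a ls)
  have "shift_map A a (shift_map A l z) = shift_map A l (shift_map A a z)"
    unfolding shift_map_def[of A a "shift_map A l z"] shift_map_def[of A a z]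
    by (simp add: shift_map_simps)
  then show ?case using Cons by simp
qed simp

lemma gen_eigenspace_iff: "z \<in> gen_eigenspace A l \<longleftrightarrow> (\<exists>n. fold (shift_map A) (replicate n l) z = 0)"
proof -
  have "shift_map A l = (\<lambda>w. A *v w - l *s w)" by (simp add: shift_map_def fun_eq_iff)
  then show ?thesis by (simp add: gen_eigenspace_def)
qed

text \<open>
  Induction on the number of linear factors that annihilate \<open>z\<close>: with \<open>w = A z - l z\<close> the iterates
  satisfy \<open>A\<^sup>k\<^sup>+\<^sup>1 z = l A\<^sup>k z + A\<^sup>k w\<close>, and \<open>w\<close> is annihilated by one factor less.
\<close>
lemma power_growth_of_annihilated:
  fixes A :: "complex ^ 'n ^ 'n"
  assumes "fold (shift_map A) ls z = 0" "\<forall>l \<in> set ls. cmod l \<le> q" "0 \<le> q" "q < R"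
  shows "\<exists>C. \<forall>k. norm (((*v) A ^^ k) z) \<le> C * R ^ k"
  using assms(1,2)
proof (induction ls arbitrary: z)
  case Nil
  have "((*v) A ^^ k) 0 = 0" for k by (induction k) auto
  with Nil show ?case by (intro exI[of _ 0]) simp
next
  case (Cons l ls)
  then have "\<exists>C. \<forall>k. norm (((*v) A ^^ k) (shift_map A l z)) \<le> C * R ^ k" by simp
  then obtain C where C: "norm (((*v) A ^^ k) (shift_map A l z)) \<le> C * R ^ k" for k by blast
  have "0 \<le> C" using C[of 0] by (smt (verit) norm_ge_zero power_0 mult_cancel_left2)
  have iter: "((*v) A ^^ Suc k) z = l *s ((*v) A ^^ k) z + ((*v) A ^^ k) (shift_map A l z)" for k
    by (induction k) (simp_all add: shift_map_def matrix_vector_right_distrib vector_scalar_commute)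
  show ?case
  proof (rule geometric_recursion_bound[OF assms(3,4) \<open>0 \<le> C\<close>])
    fix k
    have "norm (((*v) A ^^ Suc k) z)
        \<le> cmod l * norm (((*v) A ^^ k) z) + norm (((*v) A ^^ k) (shift_map A l z))"
      unfolding iter by (metis norm_triangle_ineq norm_vec_scalar_mult)
    also have "\<dots> \<le> q * norm (((*v) A ^^ k) z) + C * R ^ k"
      using Cons.prems(2) C[of k] by (intro add_mono mult_right_mono) auto
    finally show "norm (((*v) A ^^ Suc k) z) \<le> q * norm (((*v) A ^^ k) z) + C * R ^ k" .
  qed
qed

text \<open>
  The same induction for a left inverse \<open>B\<close> of \<open>A\<close>, now with
  \<open>B\<^sup>k\<^sup>+\<^sup>1 z = (B\<^sup>k z - B\<^sup>k\<^sup>+\<^sup>1 w) / l\<close>.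
\<close>
lemma inverse_power_growth_of_annihilated:
  fixes A B :: "complex ^ 'n ^ 'n"
  assumes inv: "\<And>z. B *v (A *v z) = z"
    and "fold (shift_map A) ls z = 0" "\<forall>l \<in> set ls. l \<noteq> 0 \<and> 1 / cmod l \<le> q" "0 \<le> q" "q < R"
  shows "\<exists>C. \<forall>k. norm (((*v) B ^^ k) z) \<le> C * R ^ k"
  using assms(2,3)
proof (induction ls arbitrary: z)
  case Nil
  have "((*v) B ^^ k) 0 = 0" for k by (induction k) auto
  with Nil show ?case by (intro exI[of _ 0]) simp
next
  case (Cons l ls)
  then have "\<exists>C. \<forall>k. norm (((*v) B ^^ k) (shift_map A l z)) \<le> C * R ^ k" by simp
  then obtain C where C: "norm (((*v) B ^^ k) (shift_map A l z)) \<le> C * R ^ k" for k by blast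
  have "0 \<le> C" using C[of 0] by (smt (verit) norm_ge_zero power_0 mult_cancel_left2)
  have l: "l \<noteq> 0" "1 / cmod l \<le> q" using Cons.prems(2) by auto
  have "B *v shift_map A l z = z - l *s (B *v z)"
    by (simp add: shift_map_def matrix_vector_mult_diff_distrib vector_scalar_commute inv)
  then have first: "B *v z = (1 / l) *s (z - B *v shift_map A l z)"
    using l(1) by (simp add: vector_smult_assoc)
  have iter: "((*v) B ^^ Suc k) z = (1 / l) *s (((*v) B ^^ k) z - ((*v) B ^^ Suc k) (shift_map A l z))"
    for k
  proof (induction k)
    case 0
    show ?case using first by simp
  next
    case (Suc k)
    then have "((*v) B ^^ Suc (Suc k)) z
        = B *v ((1 / l) *s (((*v) B ^^ k) z - ((*v) B ^^ Suc k) (shift_map A l z)))"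
      by simp
    also have "\<dots> = (1 / l) *s (((*v) B ^^ Suc k) z - ((*v) B ^^ Suc (Suc k)) (shift_map A l z))"
      by (simp only: vector_scalar_commute matrix_vector_mult_diff_distrib funpow.simps o_apply)
    finally show ?case .
  qed
  show ?case
  proof (rule geometric_recursion_bound[OF assms(4,5)])
    show "0 \<le> q * C * R" using assms(4,5) \<open>0 \<le> C\<close> by simp
    fix k
    have "norm (((*v) B ^^ Suc k) z)
        = 1 / cmod l * norm (((*v) B ^^ k) z - ((*v) B ^^ Suc k) (shift_map A l z))"
      unfolding iter by (simp only: norm_vec_scalar_mult norm_divide norm_one)
    also have "\<dots> \<le> q * (norm (((*v) B ^^ k) z) + C * R ^ Suc k)"
      using l C[of "Suc k"] assms(4)
      by (intro mult_mono order.trans[OF norm_triangle_ineq4] add_mono) auto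
    finally show "norm (((*v) B ^^ Suc k) z) \<le> q * norm (((*v) B ^^ k) z) + q * C * R * R ^ k"
      by (simp add: algebra_simps)
  qed
qed

definition poly_apply :: "complex poly \<Rightarrow> complex ^ 'n ^ 'n \<Rightarrow> complex ^ 'n \<Rightarrow> complex ^ 'n"
  where "poly_apply p A z = (\<Sum>i\<le>degree p. coeff p i *s ((*v) A ^^ i) z)"

lemma poly_apply_bound:
  assumes "degree p \<le> N"
  shows "poly_apply p A z = (\<Sum>i\<le>N. coeff p i *s ((*v) A ^^ i) z)"
  unfolding poly_apply_def
  by (rule sum.mono_neutral_left) (use assms in \<open>auto simp: coeff_eq_0\<close>)

lemma poly_apply_linear_factor: "poly_apply ([:- l, 1:] * q) A z = poly_apply q A (shift_map A l z)"
proof -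
  define N where "N = Suc (degree q)"
  have deg: "degree ([:- l, 1:] * q) \<le> N"
    using degree_mult_le[of "[:- l, 1:]" q] by (simp add: N_def)
  have iter: "((*v) A ^^ i) (shift_map A l z) = ((*v) A ^^ Suc i) z - l *s ((*v) A ^^ i) z" for i
    by (induction i) (simp_all add: shift_map_def matrix_vector_mult_diff_distrib vector_scalar_commute)
  have cf: "coeff ([:- l, 1:] * q) i = (case i of 0 \<Rightarrow> 0 | Suc j \<Rightarrow> coeff q j) - l * coeff q i" for i
    by (auto simp: mult_pCons_left coeff_pCons split: nat.split)
  have "poly_apply ([:- l, 1:] * q) A z
      = (\<Sum>i\<le>N. (case i of 0 \<Rightarrow> 0 | Suc j \<Rightarrow> coeff q j) *s ((*v) A ^^ i) z)
        - (\<Sum>i\<le>N. (l * coeff q i) *s ((*v) A ^^ i) z)"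
    unfolding poly_apply_bound[OF deg] cf by (simp add: vec.scale_left_diff_distrib sum_subtractf)
  also have "(\<Sum>i\<le>N. (case i of 0 \<Rightarrow> 0 | Suc j \<Rightarrow> coeff q j) *s ((*v) A ^^ i) z)
      = (\<Sum>i\<le>degree q. coeff q i *s ((*v) A ^^ Suc i) z)"
    unfolding N_def sum.atMost_Suc_shift by simp
  also have "(\<Sum>i\<le>N. (l * coeff q i) *s ((*v) A ^^ i) z)
      = (\<Sum>i\<le>degree q. (l * coeff q i) *s ((*v) A ^^ i) z)"
    unfolding N_def by (rule sum.mono_neutral_right) (auto simp: coeff_eq_0)
  also have "(\<Sum>i\<le>degree q. coeff q i *s ((*v) A ^^ Suc i) z)
        - (\<Sum>i\<le>degree q. (l * coeff q i) *s ((*v) A ^^ i) z) = poly_apply q A (shift_map A l z)"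
    unfolding poly_apply_def iter sum_subtractf[symmetric]
    by (intro sum.cong refl) (simp add: vec.scale_right_diff_distrib mult.commute)
  finally show ?thesis .
qed

lemma poly_apply_0_imp_annihilated:
  assumes "p \<noteq> 0" "poly_apply p A z = 0"
  shows "\<exists>ls. fold (shift_map A) ls z = 0"
  using assms
proof (induction "degree p" arbitrary: p z)
  case 0
  then have "poly_apply p A z = coeff p 0 *s z" "coeff p 0 \<noteq> 0"
    using leading_coeff_0_iff[of p] by (auto simp: poly_apply_def)
  with 0 have "z = 0" by simp
  then show ?case by (intro exI[of _ "[]"]) simp
next
  case (Suc n)
  \<comment> \<open>split off one root of the polynomial as a factor of the product\<close>
  have "\<not> constant (poly p)" using Suc(2) by (simp add: constant_degree)
  then obtain l where "poly p l = 0" using fundamental_theorem_of_algebra by blast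
  then obtain q where q: "p = [:- l, 1:] * q" by (metis dvdE poly_eq_0_iff_dvd)
  have "q \<noteq> 0" using Suc(3) q by auto
  have "degree p = Suc (degree q)" unfolding q using \<open>q \<noteq> 0\<close> by (subst degree_mult_eq) auto
  then have "n = degree q" using Suc(2) by simp
  from Suc(1)[OF this \<open>q \<noteq> 0\<close>] obtain ls where "fold (shift_map A) ls (shift_map A l z) = 0"
    using Suc(4) unfolding q poly_apply_linear_factor by blast
  then show ?case by (intro exI[of _ "l # ls"]) simp
qed

text \<open>
  The vectors \<open>z, A z, \<dots>, A\<^sup>n z\<close> are one more than the dimension, so they repeat or are linearly
  dependent.
\<close>
lemma ex_annihilating_polynomial:
  fixes A :: "complex ^ 'n ^ 'n"
  shows "\<exists>p. p \<noteq> 0 \<and> poly_apply p A z = 0"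
proof -
  define N where "N = CARD('n)"
  define f where "f i = ((*v) A ^^ i) z" for i
  obtain c :: "nat \<Rightarrow> complex" where c: "(\<Sum>i\<le>N. c i *s f i) = 0" "\<exists>i\<le>N. c i \<noteq> 0"
  proof (cases "inj_on f {..N}")
    case True
    then have "card (f ` {..N}) = Suc N" by (simp add: card_image)
    also have "\<dots> > vec.dim (f ` {..N})"
      using vec.dim_subset_UNIV[of "f ` {..N}"]
      by (simp add: N_def vec.dimension_def card_cart_basis)
    finally have "vec.dependent (f ` {..N})" by (intro vec.dependent_biggerset_general) simp
    then obtain u where u: "(\<Sum>v\<in>f ` {..N}. u v *s v) = 0" "\<exists>v\<in>f ` {..N}. u v \<noteq> 0"
      by (auto simp: vec.dependent_finite)
    then show thesis
      by (intro that[of "\<lambda>i. u (f i)"]) (auto simp: sum.reindex[OF True])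
  next
    case False
    then obtain i j where ij: "i \<le> N" "j \<le> N" "i \<noteq> j" "f i = f j"
      by (auto simp: inj_on_def)
    \<comment> \<open>a repetition is a linear dependence as well\<close>
    define c where "c k = (if k = i then 1 else 0) - (if k = j then 1 else (0::complex))" for k
    have "(\<Sum>k\<le>N. c k *s f k)
        = (\<Sum>k\<le>N. (if k = i then 1 else 0) *s f k) - (\<Sum>k\<le>N. (if k = j then 1 else 0) *s f k)"
      by (simp add: c_def vec.scale_left_diff_distrib sum_subtractf)
    also have "\<dots> = 0" using ij by (simp add: if_distrib[of "\<lambda>x. x *s _"] cong: if_cong)
    finally show thesis using ij by (intro that[of c]) (auto simp: c_def intro!: exI[of _ i])
  qed
  define p where "p = (\<Sum>i\<le>N. monom (c i) i)"
  have cf: "coeff p i = (if i \<le> N then c i else 0)" for i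
    by (simp add: p_def coeff_sum)
  have "degree p \<le> N" by (rule degree_le) (simp add: cf)
  moreover have "p \<noteq> 0" using c(2) cf by (metis coeff_0)
  ultimately show ?thesis using c(1)
    by (intro exI[of _ p]) (simp add: poly_apply_bound cf f_def)
qed

text \<open>
  The annihilating polynomial splits into linear factors; the factors commute, and those that do not
  belong to eigenvalues are injective and can be cancelled. This replaces the decomposition of the
  whole space into generalized eigenspaces.
\<close>
lemma annihilated_by_eigenvalues:
  fixes A :: "complex ^ 'n ^ 'n"
  obtains ls where "set ls \<subseteq> eigenvalues A" "fold (shift_map A) ls z = 0"
proof -
  obtain ls where ls: "fold (shift_map A) ls z = 0"
    using ex_annihilating_polynomial poly_apply_0_imp_annihilated by blast
  have "fold (shift_map A) (filter (\<lambda>l. l \<in> eigenvalues A) ls) z = 0"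
    using ls
  proof (induction ls arbitrary: z)
    case (Cons l ls)
    let ?w = "fold (shift_map A) (filter (\<lambda>l. l \<in> eigenvalues A) ls) z"
    have "shift_map A l ?w = 0"
      using Cons.IH[of "shift_map A l z"] Cons.prems by (simp add: fold_shift_map_commute)
    moreover from this have "?w = 0" if "l \<notin> eigenvalues A"
      using that by (auto simp: eigenvalues_def shift_map_def)
    ultimately show ?case by (simp add: fold_shift_map_commute)
  qed simp
  then show thesis by (intro that) auto
qed

section \<open>Expansive matrices and their spectral subspaces\<close>

lemma subspace_pointwise_bounds:
  fixes L :: "'i \<Rightarrow> 'a::real_normed_vector \<Rightarrow> 'b::real_normed_vector"
  assumes lin: "\<And>i. linear (L i)" and w: "\<And>i. 0 \<le> w i"
  shows "subspace {x. \<exists>C. \<forall>i. norm (L i x) \<le> C * w i}"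
  unfolding subspace_def
proof (intro conjI ballI allI; clarify)
  show "\<exists>C. \<forall>i. norm (L i 0) \<le> C * w i"
    by (intro exI[of _ 0]) (simp add: linear_0[OF lin])
next
  fix x y C1 C2 assume "\<forall>i. norm (L i x) \<le> C1 * w i" "\<forall>i. norm (L i y) \<le> C2 * w i"
  then have "norm (L i (x + y)) \<le> (C1 + C2) * w i" for i
    using norm_triangle_ineq[of "L i x" "L i y"]
    by (smt (verit) linear_add[OF lin] distrib_right)
  then show "\<exists>C. \<forall>i. norm (L i (x + y)) \<le> C * w i" by blast
next
  fix c x C assume C: "\<forall>i. norm (L i x) \<le> C * w i"
  have "norm (L i (c *\<^sub>R x)) \<le> (\<bar>c\<bar> * C) * w i" for i
    using mult_left_mono[OF C[rule_format, of i], of "\<bar>c\<bar>"] by (simp add: linear_cmul[OF lin] mult.assoc)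
  then show "\<exists>C. \<forall>i. norm (L i (c *\<^sub>R x)) \<le> C * w i" by blast
qed

text \<open>
  A finite-dimensional uniform boundedness principle: pointwise bounds on an orthonormal basis add up
  to a bound for the operator norms.
\<close>
lemma uniform_bound_on_subspace:
  fixes L :: "'i \<Rightarrow> 'a::euclidean_space \<Rightarrow> 'b::real_normed_vector"
  assumes lin: "\<And>i. linear (L i)" and w: "\<And>i. 0 \<le> w i" and U: "subspace U"
    and bound: "\<And>u. u \<in> U \<Longrightarrow> \<exists>C. \<forall>i. norm (L i u) \<le> C * w i"
  obtains C where "0 \<le> C" "\<And>i u. u \<in> U \<Longrightarrow> norm (L i u) \<le> C * w i * norm u"
proof -
  obtain E where E: "E \<subseteq> U" "pairwise orthogonal E" "\<And>x. x \<in> E \<Longrightarrow> norm x = 1"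
    "independent E" "span E = U"
    using orthonormal_basis_subspace[OF U] by metis
  have fin: "finite E" using E(4) by (rule independent_imp_finite)
  obtain C where C: "\<And>i e. e \<in> E \<Longrightarrow> norm (L i e) \<le> C e * w i"
    using bound E(1) by (metis subsetD)
  have C': "norm (L i e) \<le> \<bar>C e\<bar> * w i" if "e \<in> E" for i e
    using C[OF that, of i] mult_right_mono[OF abs_ge_self[of "C e"] w[of i]] by linarith
  show thesis
  proof (rule that)
    show "0 \<le> (\<Sum>e\<in>E. \<bar>C e\<bar>)" by (simp add: sum_nonneg)
    fix i u assume "u \<in> U"
    have expand: "(\<Sum>e\<in>E. (u \<bullet> e) *\<^sub>R e) = u"
    proof -
      have "u \<in> span E" using \<open>u \<in> U\<close> E(5) by simp
      then obtain a where a: "u = (\<Sum>e\<in>E. a e *\<^sub>R e)"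
        using span_finite[OF fin] by auto
      have "u \<bullet> e = a e" if "e \<in> E" for e
      proof -
        have "u \<bullet> e = (\<Sum>e'\<in>E. if e' = e then a e else 0)"
          unfolding a inner_sum_left
          using E(2,3) that by (intro sum.cong refl)
            (auto simp: pairwise_def orthogonal_def norm_eq_1)
        then show ?thesis using fin that by simp
      qed
      then show ?thesis using a by simp
    qed
    have "norm (L i u) = norm (\<Sum>e\<in>E. (u \<bullet> e) *\<^sub>R L i e)"
      by (subst expand[symmetric]) (simp add: linear_sum[OF lin] linear_cmul[OF lin])
    also have "\<dots> \<le> (\<Sum>e\<in>E. norm u * (\<bar>C e\<bar> * w i))"
    proof (intro sum_norm_le)
      fix e assume e: "e \<in> E"
      have "\<bar>u \<bullet> e\<bar> \<le> norm u" using Cauchy_Schwarz_ineq2[of u e] E(3)[OF e] by simp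
      then show "norm ((u \<bullet> e) *\<^sub>R L i e) \<le> norm u * (\<bar>C e\<bar> * w i)"
        using C'[OF e, of i] by (simp add: mult_mono)
    qed
    also have "\<dots> = (\<Sum>e\<in>E. \<bar>C e\<bar>) * w i * norm u"
      by (simp add: sum_distrib_left sum_distrib_right mult_ac)
    finally show "norm (L i u) \<le> (\<Sum>e\<in>E. \<bar>C e\<bar>) * w i * norm u" .
  qed
qed

lemma linear_funpow: "linear f \<Longrightarrow> linear (f ^^ k)"
  for f :: "'a::real_vector \<Rightarrow> 'a"
  by (induction k) (auto intro: linear_compose simp: linear_id[unfolded id_def] id_def)

lemma cvec_simps [simp]:
  "cvec 0 = 0" "cvec (x + y) = cvec x + cvec y" "cvec (x - y) = cvec x - cvec y"
  "cvec (a *\<^sub>R x) = complex_of_real a *s cvec x" "cvec x = 0 \<longleftrightarrow> x = 0"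
  "norm (cvec x) = norm x"
  by (simp_all add: cvec_def vec_eq_iff norm_vec_def L2_set_def)

lemma cvec_rmat: "cvec (rmat M *v x) = cmat M *v cvec x"
  by (simp add: cvec_def rmat_def cmat_def vec_eq_iff matrix_vector_mult_def)

lemma cvec_matrix: "cvec (A *v x) = map_matrix complex_of_real A *v cvec x"
  by (simp add: cvec_def vec_eq_iff matrix_vector_mult_def)

lemma norm_cvec_funpow:
  fixes f :: "real ^ 'n \<Rightarrow> real ^ 'n"
  assumes "\<And>x. cvec (f x) = A *v cvec x"
  shows "norm ((f ^^ k) x) = norm (((*v) A ^^ k) (cvec x))"
proof -
  have "cvec ((f ^^ k) x) = ((*v) A ^^ k) (cvec x)"
    by (induction k) (simp_all add: assms)
  then show ?thesis by (metis cvec_simps(6))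
qed

lemma rvec_simps [simp]:
  "rvec 0 = 0" "rvec (j + k) = rvec j + rvec k" "rvec (j - k) = rvec j - rvec k"
  "rvec (M *v k) = rmat M *v rvec k" "rvec j = rvec k \<longleftrightarrow> j = k"
  by (simp_all add: rvec_def vec_eq_iff rmat_def matrix_vector_mult_def)

lemma rvec_minus [simp]: "rvec (- k) = - rvec k"
  by (simp add: rvec_def vec_eq_iff)

locale expansive_integer_matrix =
  fixes M :: "int ^ 's ^ 's"
  assumes expansive: "expansive M"
begin

definition dilate :: "real ^ 's \<Rightarrow> real ^ 's"
  where "dilate x = rmat M *v x"

definition contract :: "real ^ 's \<Rightarrow> real ^ 's"
  where "contract x = matrix_inv (rmat M) *v x"

lemma linear_dilate: "linear dilate" and linear_contract: "linear contract"
  unfolding dilate_def[abs_def] contract_def[abs_def] by simp_all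

lemmas dilate_linear_simps [simp] =
  linear_0[OF linear_dilate] linear_add[OF linear_dilate] linear_diff[OF linear_dilate]
  linear_cmul[OF linear_dilate]

lemmas contract_linear_simps [simp] =
  linear_0[OF linear_contract] linear_add[OF linear_contract] linear_diff[OF linear_contract]
  linear_cmul[OF linear_contract]

lemma linear_dilate_funpow: "linear (dilate ^^ k)"
  and linear_contract_funpow: "linear (contract ^^ k)"
  by (simp_all add: linear_funpow linear_dilate linear_contract)

lemma rvec_dilate: "rvec (M *v k) = dilate (rvec k)"
  by (simp add: dilate_def)

lemma matrix_inv_rmat:
  "matrix_inv (rmat M) ** rmat M = mat 1" "rmat M ** matrix_inv (rmat M) = mat 1"
proof -
  have "inj ((*v) (rmat M))"
  proof (rule injI)
    fix x y assume "rmat M *v x = rmat M *v y"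
    then have "cmat M *v cvec (x - y) = 0 *s cvec (x - y)"
      unfolding cvec_rmat[symmetric] by (simp add: matrix_vector_mult_diff_distrib)
    then have "0 \<in> eigenvalues (cmat M)" if "x \<noteq> y"
      using that by (auto simp: eigenvalues_def simp del: cvec_simps(3) intro!: exI[of _ "cvec (x - y)"])
    then show "x = y" using expansive by (force simp: expansive_def)
  qed
  then obtain B where "B ** rmat M = mat 1" by (auto simp flip: matrix_left_invertible_injective)
  moreover from this have "rmat M ** B = mat 1" by (simp add: matrix_left_right_inverse)
  ultimately have "\<exists>B. rmat M ** B = mat 1 \<and> B ** rmat M = mat 1" by blast
  from someI_ex[OF this] show "matrix_inv (rmat M) ** rmat M = mat 1"
    "rmat M ** matrix_inv (rmat M) = mat 1"
    by (simp_all add: matrix_inv_def)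
qed

lemma contract_dilate [simp]: "contract (dilate x) = x"
  and dilate_contract [simp]: "dilate (contract x) = x"
  by (simp_all add: contract_def dilate_def matrix_vector_mul_assoc matrix_inv_rmat)

lemma contract_dilate_funpow [simp]: "(contract ^^ k) ((dilate ^^ k) x) = x"
  by (induction k arbitrary: x) (simp_all add: funpow_swap1)

lemma dilate_contract_funpow [simp]: "(dilate ^^ k) ((contract ^^ k) x) = x"
  by (induction k arbitrary: x) (simp_all add: funpow_swap1)

definition complex_inverse :: "complex ^ 's ^ 's"
  where "complex_inverse = map_matrix complex_of_real (matrix_inv (rmat M))"

lemma complex_inverse_cmat [simp]: "complex_inverse *v (cmat M *v z) = z" and cmat_complex_inverse [simp]: "cmat M *v (complex_inverse *v z) = z"
proof -
  have hom: "map_matrix complex_of_real (A ** B)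
      = map_matrix complex_of_real A ** map_matrix complex_of_real B" for A B :: "real^'s^'s"
    by (simp add: vec_eq_iff matrix_matrix_mult_def)
  have cm: "cmat M = map_matrix complex_of_real (rmat M)"
    by (simp add: vec_eq_iff cmat_def rmat_def)
  have one: "map_matrix complex_of_real (mat 1) = (mat 1 :: complex^'s^'s)"
    by (simp add: vec_eq_iff mat_def)
  show "complex_inverse *v (cmat M *v z) = z" "cmat M *v (complex_inverse *v z) = z"
    unfolding matrix_vector_mul_assoc complex_inverse_def cm
    by (simp_all add: hom[symmetric] matrix_inv_rmat one)
qed

lemma cvec_dilate: "cvec (dilate x) = cmat M *v cvec x"
  by (simp add: dilate_def cvec_rmat)

lemma cvec_contract: "cvec (contract x) = complex_inverse *v cvec x"
  by (simp add: contract_def complex_inverse_def cvec_matrix)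

lemma eigenvalue_gt_1: "l \<in> eigenvalues (cmat M) \<Longrightarrow> 1 < cmod l"
  using expansive by (simp add: expansive_def)

text \<open>
  Each vector is annihilated by a product over finitely many eigenvalues, whose moduli stay away
  from 1. The rate obtained here depends on the vector; over a basis it can be chosen uniformly.
\<close>
lemma contract_decay_pointwise: "\<exists>R C. 0 < R \<and> R < 1 \<and> (\<forall>k. norm ((contract ^^ k) x) \<le> C * R ^ k)"
proof -
  obtain ls where ls: "set ls \<subseteq> eigenvalues (cmat M)" "fold (shift_map (cmat M)) ls (cvec x) = 0"
    by (rule annihilated_by_eigenvalues)
  define q where "q = Max (insert (1 / 2) ((\<lambda>l. 1 / cmod l) ` set ls))"
  have gt: "1 < cmod l" if "l \<in> set ls" for l using that ls(1) eigenvalue_gt_1 by auto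
  have q: "q < 1" "1 / 2 \<le> q" "\<forall>l\<in>set ls. l \<noteq> 0 \<and> 1 / cmod l \<le> q"
  proof -
    have fin: "finite (insert (1 / 2) ((\<lambda>l. 1 / cmod l) ` set ls))" by simp
    show "q < 1" unfolding q_def using gt by (subst Max_less_iff) (auto dest: gt simp: divide_simps)
    show "1 / 2 \<le> q" unfolding q_def by (intro Max_ge fin) simp
    have "1 / cmod l \<le> q" if "l \<in> set ls" for l
      unfolding q_def using that by (intro Max_ge fin) simp
    then show "\<forall>l\<in>set ls. l \<noteq> 0 \<and> 1 / cmod l \<le> q" using gt by fastforce
  qed
  obtain C where "\<forall>k. norm (((*v) complex_inverse ^^ k) (cvec x)) \<le> C * ((1 + q) / 2) ^ k"
    using inverse_power_growth_of_annihilated[OF complex_inverse_cmat ls(2) q(3), of "(1 + q) / 2"] q(1,2) by auto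
  then show ?thesis
    unfolding norm_cvec_funpow[OF cvec_contract]
    using q(1,2) by (intro exI[of _ "(1 + q) / 2"] exI[of _ C]) auto
qed

lemma contract_decay:
  obtains R C :: real where "0 < R" "R < 1" "0 \<le> C" "\<forall>k x. norm ((contract ^^ k) x) \<le> C * R ^ k * norm x"
proof -
  obtain R C where RC: "\<And>x. 0 < R x" "\<And>x. R x < 1"
    "\<And>x k. norm ((contract ^^ k) x) \<le> C x * R x ^ k"
    using contract_decay_pointwise by metis
  define R' where "R' = Max (R ` (Basis :: (real ^ 's) set))"
  have R': "0 < R'" "R' < 1" "\<And>b. b \<in> Basis \<Longrightarrow> R b \<le> R'"
    using RC(1,2) SOME_Basis by (auto simp: R'_def Max_gr_iff simp del: Basis_real_def)
  let ?S = "{x. \<exists>C. \<forall>k. norm ((contract ^^ k) x) \<le> C * R' ^ k}"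
  have "Basis \<subseteq> ?S"
  proof
    fix b :: "real ^ 's" assume b: "b \<in> Basis"
    have "norm ((contract ^^ k) b) \<le> \<bar>C b\<bar> * R' ^ k" for k
    proof -
      have "norm ((contract ^^ k) b) \<le> C b * R b ^ k" by (rule RC(3))
      also have "\<dots> \<le> \<bar>C b\<bar> * R' ^ k"
        using R'(3)[OF b] RC(1)[of b] by (intro mult_mono power_mono) auto
      finally show ?thesis .
    qed
    then show "b \<in> ?S" by blast
  qed
  then have "x \<in> ?S" for x
    using span_minimal[OF _ subspace_pointwise_bounds[OF linear_contract_funpow, of "\<lambda>k. R' ^ k" "\<lambda>k. k"], of Basis] R'(1)
    by (auto simp: span_Basis)
  then obtain C' where "0 \<le> C'" "\<And>k u. u \<in> UNIV \<Longrightarrow> norm ((contract ^^ k) u) \<le> C' * R' ^ k * norm u"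
    using uniform_bound_on_subspace[of "\<lambda>k. contract ^^ k" "\<lambda>k. R' ^ k" UNIV]
      linear_contract_funpow R'(1) by auto
  with R' that show thesis by blast
qed

definition spectral_union :: "real \<Rightarrow> (complex ^ 's) set"
  where "spectral_union r = (\<Union>l \<in> {l \<in> eigenvalues (cmat M). cmod l = r}. gen_eigenspace (cmat M) l)"

lemma spectral_subspace_iff: "x \<in> spectral_subspace M r \<longleftrightarrow> cvec x \<in> vec.span (spectral_union r)"
  by (simp add: spectral_subspace_def spectral_union_def)

lemma spectral_union_cases:
  assumes "z \<in> spectral_union r"
  obtains l n where "l \<in> eigenvalues (cmat M)" "cmod l = r" "fold (shift_map (cmat M)) (replicate n l) z = 0"
  using assms by (auto simp: spectral_union_def gen_eigenspace_iff)

lemma subspace_spectral: "subspace (spectral_subspace M r)"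
  by (auto simp: subspace_def spectral_subspace_iff
      intro: vec.span_add vec.span_scale vec.span_zero)

text \<open>
  Whatever commutes with \<open>M\<close> preserves its generalized eigenspaces; this is used for \<open>M\<close> and for its
  inverse.
\<close>
lemma spectral_union_commute:
  assumes comm: "\<And>l z. shift_map (cmat M) l (A *v z) = A *v shift_map (cmat M) l z"
    and z: "z \<in> vec.span (spectral_union r)"
  shows "A *v z \<in> vec.span (spectral_union r)"
  using z
proof (induction rule: vec.span_induct_alt)
  case base
  show ?case by (simp add: vec.span_zero)
next
  case (step c z y)
  obtain l n where ln: "l \<in> eigenvalues (cmat M)" "cmod l = r"
    "fold (shift_map (cmat M)) (replicate n l) z = 0"
    using spectral_union_cases[OF step(1)] .
  have "fold (shift_map (cmat M)) (replicate n l) (A *v z)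
      = A *v fold (shift_map (cmat M)) (replicate n l) z" for n l z
    by (induction n arbitrary: z) (simp_all add: comm del: fold_replicate)
  then have "A *v z \<in> spectral_union r"
    using ln by (auto simp: spectral_union_def gen_eigenspace_iff intro!: exI[of _ l] exI[of _ n] simp del: fold_replicate)
  with step(2) show ?case
    by (simp add: matrix_vector_right_distrib vector_scalar_commute vec.span_add vec.span_scale vec.span_base)
qed

lemma spectral_dilate: "x \<in> spectral_subspace M r \<Longrightarrow> dilate x \<in> spectral_subspace M r"
  unfolding spectral_subspace_iff cvec_dilate
  by (rule spectral_union_commute) (simp_all add: shift_map_simps)

lemma spectral_contract: "x \<in> spectral_subspace M r \<Longrightarrow> contract x \<in> spectral_subspace M r"
  unfolding spectral_subspace_iff cvec_contract
  by (rule spectral_union_commute)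
    (simp_all add: shift_map_def matrix_vector_mult_diff_distrib vector_scalar_commute)

lemma spectral_dilate_funpow: "x \<in> spectral_subspace M r \<Longrightarrow> (dilate ^^ k) x \<in> spectral_subspace M r"
  by (induction k) (auto intro: spectral_dilate)

lemma spectral_growth_pointwise:
  fixes L :: "complex ^ 's ^ 's"
  assumes gen: "\<And>z. z \<in> spectral_union r \<Longrightarrow> \<exists>C. \<forall>k. norm (((*v) L ^^ k) z) \<le> C * R ^ k"
    and z: "z \<in> vec.span (spectral_union r)"
  shows "\<exists>C. \<forall>k. norm (((*v) L ^^ k) z) \<le> C * R ^ k"
  using z
proof (induction rule: vec.span_induct_alt)
  case base
  have "((*v) L ^^ k) 0 = 0" for k by (induction k) auto
  then show ?case by (intro exI[of _ 0]) simp
next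
  case (step c z y)
  obtain C1 where C1: "\<forall>k. norm (((*v) L ^^ k) z) \<le> C1 * R ^ k" using gen step(1) by blast
  obtain C2 where C2: "\<forall>k. norm (((*v) L ^^ k) y) \<le> C2 * R ^ k" using step(2) by blast
  have "((*v) L ^^ k) (c *s z + y) = c *s ((*v) L ^^ k) z + ((*v) L ^^ k) y" for k
    by (induction k) (simp_all add: matrix_vector_right_distrib vector_scalar_commute)
  then have "norm (((*v) L ^^ k) (c *s z + y))
      \<le> cmod c * norm (((*v) L ^^ k) z) + norm (((*v) L ^^ k) y)" for k
    by (metis norm_triangle_ineq norm_vec_scalar_mult)
  moreover have "cmod c * norm (((*v) L ^^ k) z) + norm (((*v) L ^^ k) y) \<le> (cmod c * C1 + C2) * R ^ k" for k
    using mult_left_mono[OF C1[rule_format, of k], of "cmod c"] C2[rule_format, of k] by (simp add: algebra_simps)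
  ultimately show ?case by (intro exI[of _ "cmod c * C1 + C2"]) (blast intro: order.trans)
qed

lemma spectral_dilate_growth:
  assumes "r < R" "0 \<le> r"
  obtains C where "0 \<le> C" "\<And>k x. x \<in> spectral_subspace M r \<Longrightarrow> norm ((dilate ^^ k) x) \<le> C * R ^ k * norm x"
proof (rule uniform_bound_on_subspace[OF linear_dilate_funpow _ subspace_spectral])
  fix x assume x: "x \<in> spectral_subspace M r"
  have "\<exists>C. \<forall>k. norm (((*v) (cmat M) ^^ k) (cvec x)) \<le> C * R ^ k"
  proof (rule spectral_growth_pointwise)
    fix z assume "z \<in> spectral_union r"
    then obtain l n where ln: "l \<in> eigenvalues (cmat M)" "cmod l = r"
      "fold (shift_map (cmat M)) (replicate n l) z = 0"
      using spectral_union_cases by blast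
    then show "\<exists>C. \<forall>k. norm (((*v) (cmat M) ^^ k) z) \<le> C * R ^ k"
      by (intro power_growth_of_annihilated[OF ln(3) _ assms(2,1)]) auto
  qed (use x in \<open>simp add: spectral_subspace_iff\<close>)
  then show "\<exists>C. \<forall>k. norm ((dilate ^^ k) x) \<le> C * R ^ k"
    by (simp add: norm_cvec_funpow[OF cvec_dilate])
qed (use assms that in auto)

lemma spectral_contract_growth:
  assumes "1 / r < R" "0 < r"
  obtains C where "0 \<le> C" "\<And>k x. x \<in> spectral_subspace M r \<Longrightarrow> norm ((contract ^^ k) x) \<le> C * R ^ k * norm x"
proof (rule uniform_bound_on_subspace[OF linear_contract_funpow _ subspace_spectral])
  show "0 \<le> R ^ k" for k using assms by (smt (verit) divide_pos_pos zero_le_power)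
  fix x assume x: "x \<in> spectral_subspace M r"
  have "\<exists>C. \<forall>k. norm (((*v) complex_inverse ^^ k) (cvec x)) \<le> C * R ^ k"
  proof (rule spectral_growth_pointwise)
    fix z assume "z \<in> spectral_union r"
    then obtain l n where ln: "l \<in> eigenvalues (cmat M)" "cmod l = r"
      "fold (shift_map (cmat M)) (replicate n l) z = 0"
      using spectral_union_cases by blast
    then show "\<exists>C. \<forall>k. norm (((*v) complex_inverse ^^ k) z) \<le> C * R ^ k"
      using assms by (intro inverse_power_growth_of_annihilated[OF complex_inverse_cmat ln(3) _ _ assms(1)]) auto
  qed (use x in \<open>simp add: spectral_subspace_iff\<close>)
  then show "\<exists>C. \<forall>k. norm ((contract ^^ k) x) \<le> C * R ^ k"
    by (simp add: norm_cvec_funpow[OF cvec_contract])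
qed (use that in auto)

text \<open>
  Since \<open>M\<close> is real, the conjugate of an eigenvector belongs to the conjugate eigenvalue, which has the
  same modulus. So the real and imaginary parts of an eigenvector lie in the spectral subspace, and
  one of them is not zero.
\<close>
lemma spectral_nontrivial:
  assumes "r \<in> eigenvalue_moduli M"
  obtains h where "h \<in> spectral_subspace M r" "h \<noteq> 0"
proof -
  obtain l z where l: "cmod l = r" "z \<noteq> 0" and eig: "cmat M *v z = l *s z"
    using assms by (auto simp: eigenvalue_moduli_def eigenvalues_def)
  define w where "w = (\<chi> i. cnj (z $ i))"
  have eig': "cmat M *v w = cnj l *s w"
  proof -
    have "cnj ((cmat M *v z) $ i) = cnj ((l *s z) $ i)" for i using eig by simp
    then show ?thesis by (simp add: vec_eq_iff matrix_vector_mult_def cmat_def w_def)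
  qed
  have w0: "w \<noteq> 0" using l(2) by (auto simp: w_def vec_eq_iff)
  have in_span: "z \<in> vec.span (spectral_union r)" "w \<in> vec.span (spectral_union r)"
  proof -
    have "a \<in> vec.span (spectral_union r)"
      if "cmod m = r" "a \<noteq> 0" "cmat M *v a = m *s a" for a m
    proof -
      have "m \<in> eigenvalues (cmat M)" using that by (auto simp: eigenvalues_def)
      moreover have "a \<in> gen_eigenspace (cmat M) m"
        unfolding gen_eigenspace_def using that(3) by (auto intro!: exI[of _ 1])
      ultimately show ?thesis
        using that(1) by (auto simp: spectral_union_def intro!: vec.span_base)
    qed
    from this[of l z] this[of "cnj l" w]
    show "z \<in> vec.span (spectral_union r)" "w \<in> vec.span (spectral_union r)"
      using l eig eig' w0 by auto
  qed
  define x where "x = (\<chi> i. Re (z $ i))"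
  define y where "y = (\<chi> i. Im (z $ i))"
  have "cvec x = (1 / 2) *s (z + w)" "cvec y = (1 / (2 * \<i>)) *s (z - w)"
    by (auto simp: cvec_def x_def y_def w_def vec_eq_iff complex_eq_iff)
  then have "x \<in> spectral_subspace M r" "y \<in> spectral_subspace M r"
    using in_span by (simp_all add: spectral_subspace_iff vec.span_scale vec.span_add vec.span_diff)
  moreover have "x \<noteq> 0 \<or> y \<noteq> 0"
    using l(2) by (auto simp: x_def y_def vec_eq_iff complex_eq_iff)
  ultimately show thesis using that by blast
qed

end

section \<open>Lattice points and radix expansions\<close>

lemma finite_lattice_points:
  assumes "bounded A"
  shows "finite {k :: int ^ 'n. rvec k \<in> A}"
proof -
  obtain B where B: "\<And>x. x \<in> A \<Longrightarrow> norm x \<le> B" using assms by (auto simp: bounded_iff)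
  have "{k :: int ^ 'n. rvec k \<in> A} \<subseteq> vec_lambda ` (PiE UNIV (\<lambda>_. {- \<lceil>B\<rceil>..\<lceil>B\<rceil>}))"
  proof
    fix k :: "int ^ 'n" assume "k \<in> {k. rvec k \<in> A}"
    then have "norm (rvec k) \<le> B" using B by simp
    then have "\<bar>real_of_int (k $ i)\<bar> \<le> B" for i
      using component_le_norm_cart[of "rvec k" i] by (simp add: rvec_def)
    then have "k $ i \<in> {- \<lceil>B\<rceil>..\<lceil>B\<rceil>}" for i
      by (smt (verit) atLeastAtMost_iff ceiling_mono ceiling_of_int le_of_int_ceiling of_int_le_iff of_int_minus)
    then show "k \<in> vec_lambda ` (PiE UNIV (\<lambda>_. {- \<lceil>B\<rceil>..\<lceil>B\<rceil>}))"
      by (intro image_eqI[of _ _ "($) k"]) auto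
  qed
  then show ?thesis by (rule finite_subset) (intro finite_imageI finite_PiE; simp)
qed

definition floor_vec :: "real ^ 'n \<Rightarrow> int ^ 'n"
  where "floor_vec x = (\<chi> i. \<lfloor>x $ i\<rfloor>)"

lemma norm_minus_floor_vec: "norm (x - rvec (floor_vec x)) \<le> CARD('n)" for x :: "real ^ 'n"
proof -
  have "norm (x - rvec (floor_vec x)) \<le> (\<Sum>i\<in>UNIV. \<bar>(x - rvec (floor_vec x)) $ i\<bar>)"
    by (rule norm_le_l1_cart)
  also have "\<dots> \<le> (\<Sum>i\<in>(UNIV :: 'n set). 1)"
    by (intro sum_mono) (simp add: rvec_def floor_vec_def, linarith)
  finally show ?thesis by simp
qed

text \<open>
  Translating \<open>z\<close> by its integer part reduces the count for arbitrary \<open>z\<close> to the lattice points of one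
  fixed ball.
\<close>
lemma uniform_lattice_point_count:
  fixes A :: "(real ^ 'n) set"
  assumes "bounded A"
  obtains N where "\<And>z. card {k :: int ^ 'n. z - rvec k \<in> A} \<le> N" "\<And>z. finite {k :: int ^ 'n. z - rvec k \<in> A}"
proof -
  obtain B where B: "\<And>x. x \<in> A \<Longrightarrow> norm x \<le> B" using assms by (auto simp: bounded_iff)
  define F where "F = {k :: int ^ 'n. rvec k \<in> cball 0 (B + CARD('n))}"
  have fin: "finite F" unfolding F_def by (rule finite_lattice_points) simp
  have sub: "(\<lambda>k. k - floor_vec z) ` {k. z - rvec k \<in> A} \<subseteq> F" for z
  proof clarify
    fix k assume "z - rvec k \<in> A"
    have "norm (rvec (k - floor_vec z)) = norm ((z - rvec (floor_vec z)) - (z - rvec k))" by simp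
    also have "\<dots> \<le> CARD('n) + B"
      using B[OF \<open>z - rvec k \<in> A\<close>] norm_minus_floor_vec[of z] by (intro order.trans[OF norm_triangle_ineq4]) simp
    finally show "k - floor_vec z \<in> F" by (simp add: F_def)
  qed
  have inj: "inj_on (\<lambda>k. k - floor_vec z) {k. z - rvec k \<in> A}" for z by (simp add: inj_on_def)
  show thesis
    using that[of "card F"] card_inj_on_le[OF inj sub fin] inj_on_finite[OF inj sub fin] by blast
qed

lemma closed_range_rvec: "closed (range (rvec :: int ^ 'n \<Rightarrow> real ^ 'n))"
proof -
  have "range (rvec :: int ^ 'n \<Rightarrow> real ^ 'n) = {x. \<forall>i. x $ i \<in> \<int>}"
  proof (intro equalityI subsetI)
    fix x :: "real ^ 'n" assume "x \<in> {x. \<forall>i. x $ i \<in> \<int>}"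
    then have "x = rvec (floor_vec x)" by (auto simp: vec_eq_iff rvec_def floor_vec_def)
    then show "x \<in> range rvec" by blast
  qed (auto simp: rvec_def)
  moreover have "closed {x :: real ^ 'n. \<forall>i. x $ i \<in> \<int>}"
    unfolding Collect_all_eq
  proof (intro closed_INT ballI)
    fix i :: 'n
    have "closed ((\<lambda>x :: real ^ 'n. x $ i) -` \<int>)"
      by (intro closed_vimage closed_Ints continuous_intros)
    then show "closed {x :: real ^ 'n. x $ i \<in> \<int>}" by (simp add: vimage_def)
  qed
  ultimately show ?thesis by simp
qed

context expansive_integer_matrix
begin

lemma radix_set_iff:
  "x \<in> radix_set M S \<longleftrightarrow> (\<exists>\<gamma>. (\<forall>j. \<gamma> j \<in> S) \<and> (\<lambda>j. (contract ^^ Suc j) (rvec (\<gamma> j))) sums x)"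
proof -
  have "(*v) (matrix_inv (rmat M)) = contract" by (simp add: contract_def fun_eq_iff)
  then show ?thesis by (simp add: radix_set_def)
qed

lemma contract_funpow_tendsto_0:
  assumes "bounded H" "\<And>n. X n \<in> H"
  shows "(\<lambda>n. (contract ^^ n) (X n)) \<longlonglongrightarrow> 0"
proof -
  obtain B where B: "\<And>x. x \<in> H \<Longrightarrow> norm x \<le> B" using assms by (auto simp: bounded_iff)
  obtain R C :: real where RC: "0 < R" "R < 1" "0 \<le> C" "\<forall>k x. norm ((contract ^^ k) x) \<le> C * R ^ k * norm x"
    by (rule contract_decay)
  have "norm ((contract ^^ n) (X n)) \<le> C * B * R ^ n" for n
  proof -
    have "norm ((contract ^^ n) (X n)) \<le> C * R ^ n * norm (X n)" by (rule RC(4)[rule_format])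
    also have "\<dots> \<le> C * R ^ n * B" using RC(1-3) B[OF assms(2)] by (intro mult_left_mono) auto
    finally show ?thesis by (simp add: mult_ac)
  qed
  moreover have "(\<lambda>n. C * B * R ^ n) \<longlonglongrightarrow> 0"
    using RC(1-3) by (intro tendsto_mult_right_zero LIMSEQ_power_zero) simp
  ultimately show ?thesis by (rule Lim_null_comparison[OF always_eventually[OF allI]])
qed

text \<open>
  For finite \<open>S\<close> the radix set is the largest bounded set in which every point \<open>x\<close> has a successor
  \<open>M x - d\<close> with \<open>d \<in> S\<close>: following the successors produces the digits, and the remainder \<open>B\<^sup>n x\<^sub>n\<close>
  tends to 0 as the \<open>x\<^sub>n\<close> stay bounded. Closure under prepending a digit, closedness of the radix set and the
  inclusion of the support of \<open>\<phi>\<close> in \<open>K\<close> all follow from this one principle.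
\<close>
lemma radix_set_coinduct:
  assumes "bounded H" and step: "\<And>x. x \<in> H \<Longrightarrow> \<exists>d\<in>S. dilate x - rvec d \<in> H"
  shows "H \<subseteq> radix_set M S"
proof
  fix x assume "x \<in> H"
  obtain \<delta> where \<delta>: "\<And>x. x \<in> H \<Longrightarrow> \<delta> x \<in> S" "\<And>x. x \<in> H \<Longrightarrow> dilate x - rvec (\<delta> x) \<in> H"
    using step by metis
  define X where "X n = ((\<lambda>y. dilate y - rvec (\<delta> y)) ^^ n) x" for n
  have X0: "X 0 = x" and X_Suc: "X (Suc n) = dilate (X n) - rvec (\<delta> (X n))" for n
    by (simp_all add: X_def)
  have X_in: "X n \<in> H" for n
    by (induction n) (auto simp: X0 X_Suc \<open>x \<in> H\<close> \<delta>)
  have partial: "(\<Sum>j<n. (contract ^^ Suc j) (rvec (\<delta> (X j)))) = x - (contract ^^ n) (X n)" for n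
  proof (induction n)
    case 0
    show ?case by (simp add: X0)
  next
    case (Suc n)
    have "rvec (\<delta> (X n)) = dilate (X n) - X (Suc n)" by (simp add: X_Suc)
    then have "(contract ^^ Suc n) (rvec (\<delta> (X n)))
        = (contract ^^ n) (X n) - (contract ^^ Suc n) (X (Suc n))"
      by (simp only: linear_diff[OF linear_contract_funpow])
        (simp only: funpow_Suc_right o_apply contract_dilate)
    then show ?case using Suc by (simp only: sum.lessThan_Suc) simp
  qed
  have "(\<lambda>n. x - (contract ^^ n) (X n)) \<longlonglongrightarrow> x - 0"
    by (intro tendsto_diff tendsto_const contract_funpow_tendsto_0[OF assms(1) X_in])
  then have "(\<lambda>j. (contract ^^ Suc j) (rvec (\<delta> (X j)))) sums x"
    unfolding sums_def partial by simp
  then show "x \<in> radix_set M S"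
    unfolding radix_set_iff using \<delta>(1)[OF X_in] by (intro exI[of _ "\<lambda>j. \<delta> (X j)"]) simp
qed

lemma radix_set_step:
  assumes "x \<in> radix_set M S"
  shows "\<exists>d\<in>S. dilate x - rvec d \<in> radix_set M S"
proof -
  obtain \<gamma> where \<gamma>: "\<And>j. \<gamma> j \<in> S" "(\<lambda>j. (contract ^^ Suc j) (rvec (\<gamma> j))) sums x"
    using assms unfolding radix_set_iff by blast
  have "(\<lambda>j. dilate ((contract ^^ Suc j) (rvec (\<gamma> j)))) sums dilate x"
    using \<gamma>(2) linear_dilate by (intro bounded_linear.sums[of dilate]) (auto simp: linear_conv_bounded_linear)
  then have "(\<lambda>j. (contract ^^ j) (rvec (\<gamma> j))) sums dilate x" by simp
  then have "(\<lambda>j. (contract ^^ Suc j) (rvec (\<gamma> (Suc j)))) sums (dilate x - rvec (\<gamma> 0))"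
    by (subst sums_Suc_iff) simp
  then have "dilate x - rvec (\<gamma> 0) \<in> radix_set M S"
    unfolding radix_set_iff using \<gamma>(1) by (intro exI[of _ "\<lambda>j. \<gamma> (Suc j)"]) simp
  then show ?thesis using \<gamma>(1) by blast
qed

lemma bounded_radix_set:
  assumes "finite S"
  shows "bounded (radix_set M S)"
proof -
  obtain B where B: "\<And>d. d \<in> S \<Longrightarrow> norm (rvec d) \<le> B"
    using finite_imp_bounded[OF finite_imageI[OF assms, of rvec]] by (auto simp: bounded_iff)
  obtain R C :: real where RC: "0 < R" "R < 1" "0 \<le> C" "\<forall>k x. norm ((contract ^^ k) x) \<le> C * R ^ k * norm x"
    by (rule contract_decay)
  have "norm x \<le> (\<Sum>j. C * B * R * R ^ j)" if x: "x \<in> radix_set M S" for x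
  proof -
    obtain \<gamma> where \<gamma>: "\<And>j. \<gamma> j \<in> S" "(\<lambda>j. (contract ^^ Suc j) (rvec (\<gamma> j))) sums x"
      using x unfolding radix_set_iff by blast
    have "norm ((contract ^^ Suc j) (rvec (\<gamma> j))) \<le> C * B * R * R ^ j" for j
    proof -
      have "norm ((contract ^^ Suc j) (rvec (\<gamma> j))) \<le> C * R ^ Suc j * norm (rvec (\<gamma> j))" by (rule RC(4)[rule_format])
      also have "\<dots> \<le> C * R ^ Suc j * B" using RC(1-3) B[OF \<gamma>(1)] by (intro mult_left_mono) auto
      finally show ?thesis by (simp add: mult_ac)
    qed
    moreover have "summable (\<lambda>j. C * B * R * R ^ j)"
      using RC(1-3) by (intro summable_mult summable_geometric) simp
    ultimately show ?thesis
      unfolding sums_unique[OF \<gamma>(2)] by (rule norm_suminf_le)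
  qed
  then show ?thesis by (auto simp: bounded_iff)
qed

lemma radix_set_cons:
  assumes "finite S" "d \<in> S" "x \<in> radix_set M S"
  shows "contract (x + rvec d) \<in> radix_set M S"
proof -
  have "insert (contract (x + rvec d)) (radix_set M S) \<subseteq> radix_set M S"
  proof (rule radix_set_coinduct)
    show "bounded (insert (contract (x + rvec d)) (radix_set M S))"
      using bounded_radix_set[OF assms(1)] by simp
    show "\<exists>e\<in>S. dilate y - rvec e \<in> insert (contract (x + rvec d)) (radix_set M S)"
      if "y \<in> insert (contract (x + rvec d)) (radix_set M S)" for y
    proof (cases "y \<in> radix_set M S")
      case True
      then show ?thesis using radix_set_step by blast
    next
      case False
      then have "dilate y = x + rvec d" using that by (simp del: contract_linear_simps)
      then show ?thesis using assms(2,3) by (intro bexI[of _ d]) auto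
    qed
  qed
  then show ?thesis by simp
qed

lemma continuous_on_contract: "continuous_on A (\<lambda>x. contract (f x))" if "continuous_on A f"
  using bounded_linear.continuous_on[OF _ that] linear_contract by (simp add: linear_conv_bounded_linear)

lemma compact_radix_set:
  assumes "finite S"
  shows "compact (radix_set M S)"
proof -
  let ?G = "radix_set M S"
  have cpt: "compact (closure ?G)" using bounded_radix_set[OF assms] by (simp add: compact_closure)
  have "closure ?G \<subseteq> ?G"
  proof (rule radix_set_coinduct)
    show "bounded (closure ?G)" using cpt compact_imp_bounded by blast
    fix x assume x: "x \<in> closure ?G"
    let ?H = "\<Union>d\<in>S. (\<lambda>y. contract (y + rvec d)) ` closure ?G"
    have "closed ?H"
      using assms cpt
      by (intro closed_UN compact_imp_closed ballI compact_continuous_image continuous_on_contract continuous_intros)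
    moreover have "?G \<subseteq> ?H"
    proof
      fix y assume "y \<in> ?G"
      then obtain d where d: "d \<in> S" "dilate y - rvec d \<in> ?G" using radix_set_step by blast
      have "y = contract ((dilate y - rvec d) + rvec d)" by simp
      then show "y \<in> ?H" using d closure_subset by blast
    qed
    ultimately have "x \<in> ?H" using x closure_minimal by blast
    then obtain d y where "d \<in> S" "y \<in> closure ?G" "x = contract (y + rvec d)" by blast
    then show "\<exists>d\<in>S. dilate x - rvec d \<in> closure ?G"
      by (intro bexI[of _ d]) (simp_all del: contract_linear_simps)
  qed
  then have "closure ?G = ?G" using closure_subset by blast
  then show ?thesis using cpt by simp
qed

end

section \<open>Digit systems and their tile\<close>

locale digit_system = expansive_integer_matrix M for M :: "int ^ 's ^ 's" +
  fixes D :: "(int ^ 's) set"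
  assumes digits: "complete_digit_set M D" and zero_digit: "0 \<in> D"
begin

abbreviation tile :: "(real ^ 's) set"
  where "tile \<equiv> radix_set M D"

lemma digit_remainder: "\<exists>d\<in>D. \<exists>j. k = d + M *v j"
  using digits unfolding complete_digit_set_def by (metis diff_eq_eq add.commute)

lemma digit_unique: "d \<in> D \<Longrightarrow> e \<in> D \<Longrightarrow> d - e = M *v j \<Longrightarrow> d = e"
  using digits unfolding complete_digit_set_def
  by (metis diff_self matrix_vector_mult_0_right)

text \<open>
  Subtracting \<open>M\<close> times an integer part moves each digit into a fixed bounded set, without changing its
  class modulo \<open>M\<close>; distinct digits have distinct classes.
\<close>
lemma finite_digits: "finite D"
proof -
  define red where "red d = d - M *v floor_vec (contract (rvec d))" for d
  define A where "A = dilate ` cball 0 (CARD('s))"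
  have "bounded A"
    unfolding A_def using linear_dilate by (intro bounded_linear_image) (auto simp: linear_conv_bounded_linear)
  then have "finite {k :: int ^ 's. rvec k \<in> A}" by (rule finite_lattice_points)
  moreover have "red ` D \<subseteq> {k. rvec k \<in> A}"
  proof clarify
    fix d
    have "rvec (red d) = dilate (contract (rvec d) - rvec (floor_vec (contract (rvec d))))"
      unfolding red_def by (simp add: rvec_dilate del: rvec_simps(4))
    then show "rvec (red d) \<in> A"
      unfolding A_def using norm_minus_floor_vec by (auto simp del: dilate_linear_simps intro!: imageI)
  qed
  moreover have "inj_on red D"
  proof (rule inj_onI)
    fix d e assume de: "d \<in> D" "e \<in> D" "red d = red e"
    then have "d - e = M *v (floor_vec (contract (rvec d)) - floor_vec (contract (rvec e)))"
      by (simp add: red_def matrix_vector_mult_diff_distrib algebra_simps)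
    then show "d = e" using digit_unique de by blast
  qed
  ultimately show ?thesis by (meson finite_subset inj_on_finite)
qed

lemmas compact_tile = compact_radix_set[OF finite_digits]
  and bounded_tile = bounded_radix_set[OF finite_digits]

text \<open>
  The point with leading digits \<open>ds\<close> whose tail is expanded as \<open>x\<close> is; the first digit of the list is the
  leading one, so that it corresponds to the leftmost factor of a matrix word.
\<close>
definition place :: "(int ^ 's) list \<Rightarrow> real ^ 's \<Rightarrow> real ^ 's"
  where "place ds x = foldr (\<lambda>d y. contract (y + rvec d)) ds x"

lemma place_simps [simp]:
  "place [] x = x" "place (d # ds) x = contract (place ds x + rvec d)"
  by (simp_all add: place_def)

lemma place_in_tile: "set ds \<subseteq> D \<Longrightarrow> x \<in> tile \<Longrightarrow> place ds x \<in> tile"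
  by (induction ds) (auto intro: radix_set_cons[OF finite_digits] simp del: contract_linear_simps)

lemma place_diff: "place ds y - place ds x = (contract ^^ length ds) (y - x)"
proof (induction ds)
  case (Cons d ds)
  have "place (d # ds) y - place (d # ds) x = contract (place ds y - place ds x)" by simp
  then show ?case unfolding Cons by simp
qed simp

text \<open>
  Expanding \<open>k = d\<^sub>0 + M d\<^sub>1 + \<dots> + M\<^sup>n\<^sup>-\<^sup>1 d\<^sub>n\<^sub>-\<^sub>1 + M\<^sup>n j\<close> in digits: contracting a translate of the tile
  \<open>n\<close> times gives a piece of a translate of the tile.
\<close>
lemma contract_lattice_shift:
  "\<exists>ds j. length ds = n \<and> set ds \<subseteq> D \<and> (\<forall>x. (contract ^^ n) (rvec k + x) = rvec j + place ds x)"
proof (induction n)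
  case 0
  show ?case by simp
next
  case (Suc n)
  then obtain ds j where IH: "length ds = n" "set ds \<subseteq> D"
    "\<And>x. (contract ^^ n) (rvec k + x) = rvec j + place ds x" by blast
  obtain d i where d: "d \<in> D" "j = d + M *v i" using digit_remainder by blast
  have "(contract ^^ Suc n) (rvec k + x) = rvec i + place (d # ds) x" for x
    by (simp add: IH(3)) (simp add: d(2) rvec_dilate del: rvec_simps(4))
  then show ?case using IH d by (intro exI[of _ "d # ds"] exI[of _ i]) simp
qed

lemma zero_in_tile: "0 \<in> tile"
proof -
  have "{0} \<subseteq> tile" by (rule radix_set_coinduct) (auto intro!: bexI[of _ 0] zero_digit)
  then show ?thesis by simp
qed

lemma tile_expansion:
  assumes "x \<in> tile"
  shows "\<exists>ds y. length ds = n \<and> set ds \<subseteq> D \<and> y \<in> tile \<and> x = place ds y"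
  using assms
proof (induction n arbitrary: x)
  case 0
  then show ?case by auto
next
  case (Suc n)
  obtain d where d: "d \<in> D" "dilate x - rvec d \<in> tile" using radix_set_step[OF Suc(2)] by blast
  from Suc(1)[OF this(2)] obtain ds y where
    "length ds = n" "set ds \<subseteq> D" "y \<in> tile" "dilate x - rvec d = place ds y" by blast
  moreover from this(4)[symmetric] have "place (d # ds) y = x"
    by (simp del: contract_linear_simps)
  ultimately show ?case using d by (intro exI[of _ "d # ds"] exI[of _ y]) auto
qed

text \<open>
  The points of \<open>B\<^sup>n \<int>\<^sup>s\<close> lie in translates of the tile, because 0 is a digit. They become dense, and the
  union of the translates is closed.
\<close>
lemma tile_translates_cover: "\<exists>k. x - rvec k \<in> tile"
proof -
  let ?S = "{y + g | y g. y \<in> range rvec \<and> g \<in> tile}"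
  have closed: "closed ?S"
    using closed_compact_sums[OF closed_range_rvec compact_tile]
    by (rule back_subst[of closed]) blast
  define X where "X n = (contract ^^ n) (rvec (floor_vec ((dilate ^^ n) x)))" for n
  have "X n \<in> ?S" for n
  proof -
    obtain ds j where "set ds \<subseteq> D" "X n = rvec j + place ds 0"
      using contract_lattice_shift[of n "floor_vec ((dilate ^^ n) x)"] unfolding X_def by (metis add.right_neutral)
    then show ?thesis using place_in_tile zero_in_tile by blast
  qed
  moreover have "X \<longlonglongrightarrow> x"
  proof -
    have "(\<lambda>n. (contract ^^ n) ((dilate ^^ n) x - rvec (floor_vec ((dilate ^^ n) x)))) \<longlonglongrightarrow> 0"
      by (rule contract_funpow_tendsto_0[of "cball 0 (CARD('s))"]) (use norm_minus_floor_vec in auto)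
    then have "(\<lambda>n. x - X n) \<longlonglongrightarrow> 0"
      by (simp add: linear_diff[OF linear_contract_funpow] X_def)
    from tendsto_diff[OF tendsto_const this, of x] show ?thesis by simp
  qed
  ultimately have "x \<in> ?S" using closed_sequentially[OF closed] by blast
  then obtain k g where "g \<in> tile" "x = rvec k + g" by blast
  then show ?thesis by (intro exI[of _ k]) simp
qed

end

section \<open>Overlaps of tiles\<close>

text \<open>
  The half-open cubes partition the space, which allows a set to be cut into pieces and reassembled by
  integer translations.
\<close>
definition unit_cell :: "int ^ 'n \<Rightarrow> (real ^ 'n) set"
  where "unit_cell k = {x. \<forall>i. real_of_int (k $ i) \<le> x $ i \<and> x $ i < real_of_int (k $ i) + 1}"

lemma unit_cell_iff: "x \<in> unit_cell k \<longleftrightarrow> floor_vec x = k"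
  by (auto simp: unit_cell_def floor_vec_def vec_eq_iff floor_eq_iff)

lemma emeasure_lebesgue_translation:
  "emeasure lebesgue ((\<lambda>x :: 'a::euclidean_space. a + x) ` S) = emeasure lebesgue S"
  using emeasure_lebesgue_affine[of 1 a S] by (simp add: add.commute)

lemma unit_cell_measurable: "unit_cell k \<in> sets lebesgue"
proof -
  have "unit_cell k = (\<Inter>i. {x. real_of_int (k $ i) \<le> x $ i} \<inter> {x. x $ i < real_of_int (k $ i) + 1})"
    by (auto simp: unit_cell_def)
  also have "\<dots> \<in> sets borel"
    using closed_halfspace_component_ge_cart open_halfspace_component_lt_cart
    by (intro sets.finite_INT sets.Int borel_closed borel_open) auto
  finally show ?thesis by (simp add: sets_completionI_sets)
qed

text \<open>
  Cut \<open>A\<close> along the unit cubes and translate every piece into the cube at the origin: the pieces then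
  cover the open unit cube.
\<close>
lemma emeasure_ge_1_of_lattice_cover:
  fixes A :: "(real ^ 'n) set"
  assumes A: "A \<in> sets lebesgue" "bounded A" and cover: "\<And>x. \<exists>k. x - rvec k \<in> A"
  shows "1 \<le> emeasure lebesgue A"
proof -
  define F where "F = floor_vec ` A"
  define P where "P k = A \<inter> unit_cell k" for k
  have "finite F"
  proof -
    obtain B where B: "\<And>x. x \<in> A \<Longrightarrow> norm x \<le> B" using A(2) by (auto simp: bounded_iff)
    have "F \<subseteq> {k. rvec k \<in> cball 0 (B + CARD('n))}"
    proof (clarsimp simp: F_def)
      fix x assume "x \<in> A"
      have "norm (rvec (floor_vec x)) = norm (x - (x - rvec (floor_vec x)))" by simp
      also have "\<dots> \<le> B + CARD('n)"
        using B[OF \<open>x \<in> A\<close>] norm_minus_floor_vec[of x] by (intro order.trans[OF norm_triangle_ineq4]) simp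
      finally show "norm (rvec (floor_vec x)) \<le> B + CARD('n)" .
    qed
    then show ?thesis by (rule finite_subset) (rule finite_lattice_points, simp)
  qed
  have P_meas: "P k \<in> sets lebesgue" for k
    unfolding P_def using A(1) unit_cell_measurable by (rule sets.Int)
  have "box 0 (\<chi> i. 1) \<subseteq> (\<Union>k\<in>F. (\<lambda>x. - rvec k + x) ` P k)"
  proof
    fix x :: "real ^ 'n" assume x: "x \<in> box 0 (\<chi> i. 1)"
    obtain k where k: "x - rvec k \<in> A" using cover by blast
    have "floor_vec (x - rvec k) = - k"
      using x by (auto simp: floor_vec_def rvec_def vec_eq_iff mem_box_cart floor_eq_iff less_imp_le)
    then have "x - rvec k \<in> P (- k)" "- k \<in> F"
      using k by (auto simp: P_def unit_cell_iff F_def intro: image_eqI[rotated])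
    then show "x \<in> (\<Union>k\<in>F. (\<lambda>x. - rvec k + x) ` P k)"
      by (intro UN_I[of "- k"] image_eqI[of _ _ "x - rvec k"]) auto
  qed
  then have "emeasure lebesgue (box 0 (\<chi> i. 1) :: (real ^ 'n) set)
      \<le> emeasure lebesgue (\<Union>k\<in>F. (\<lambda>x. - rvec k + x) ` P k)"
    using P_meas by (intro emeasure_mono sets.finite_UN \<open>finite F\<close> lebesgue_sets_translation)
  also have "\<dots> \<le> (\<Sum>k\<in>F. emeasure lebesgue ((\<lambda>x. - rvec k + x) ` P k))"
    by (intro emeasure_subadditive_finite \<open>finite F\<close> image_subsetI lebesgue_sets_translation P_meas)
  also have "\<dots> = (\<Sum>k\<in>F. emeasure lebesgue (P k))"
    by (simp only: emeasure_lebesgue_translation)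
  also have "\<dots> = emeasure lebesgue (\<Union>k\<in>F. P k)"
    using P_meas by (intro sum_emeasure \<open>finite F\<close>) (auto simp: disjoint_family_on_def P_def unit_cell_iff)
  also have "\<dots> \<le> emeasure lebesgue A" by (intro emeasure_mono A) (auto simp: P_def)
  finally have le: "emeasure lebesgue (box 0 (\<chi> i. 1) :: (real ^ 'n) set) \<le> emeasure lebesgue A" .
  have "emeasure lebesgue (box 0 (\<chi> i. 1) :: (real ^ 'n) set) = 1"
  proof -
    have one: "(\<chi> i. 1) \<bullet> b = 1" if "b \<in> Basis" for b :: "real ^ 'n"
      using that by (auto simp: Basis_vec_def inner_axis)
    have "emeasure lborel (box 0 (\<chi> i. 1) :: (real ^ 'n) set) = (\<Prod>b\<in>Basis. ((\<chi> i. 1) - 0 :: real ^ 'n) \<bullet> b)"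
      by (rule emeasure_lborel_box) (simp add: one)
    also have "\<dots> = 1" by (simp add: one)
    finally show ?thesis by simp
  qed
  with le show ?thesis by simp
qed

context digit_system
begin

lemma tile_measurable: "tile \<in> sets lebesgue"
  using compact_tile by (simp add: borel_compact sets_completionI_sets)

text \<open>
  If \<open>G\<close> met \<open>h + G\<close> in positive measure, then \<open>G\<close> without this intersection would have measure less
  than 1. But its translates still cover: for \<open>y \<in> G\<close> take the last of the points \<open>y - n h\<close> that lies in
  the bounded set \<open>G\<close>.
\<close>
lemma tile_overlap_negligible:
  assumes one: "emeasure lebesgue tile = 1" and "j \<noteq> k"
  shows "negligible ((\<lambda>x. rvec j + x) ` tile \<inter> (\<lambda>x. rvec k + x) ` tile)"
proof -
  \<comment> \<open>the overlap of the translates by j and k is a translate of the overlap of G and h + G\<close>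
  define h where "h = k - j"
  define O' where "O' = tile \<inter> (\<lambda>x. rvec h + x) ` tile"
  have "h \<noteq> 0" using assms(2) by (simp add: h_def)
  then have h: "0 < norm (rvec h)" using rvec_simps(5)[of h 0] by simp
  have meas: "O' \<in> sets lebesgue" "tile - O' \<in> sets lebesgue"
    unfolding O'_def using tile_measurable lebesgue_sets_translation[OF tile_measurable] by auto
  have "1 \<le> emeasure lebesgue (tile - O')"
  proof (rule emeasure_ge_1_of_lattice_cover)
    show "bounded (tile - O')" using bounded_tile by (rule bounded_subset) auto
    fix x
    obtain i where i: "x - rvec i \<in> tile" using tile_translates_cover by blast
    define y where "y = x - rvec i"
    have rv: "rvec (of_nat n * h) = real n *\<^sub>R rvec h" for n
      by (simp add: rvec_def vec_eq_iff of_nat_index)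
    define N where "N = {n. y - real n *\<^sub>R rvec h \<in> tile}"
    have "finite N"
    proof -
      obtain B where B: "\<And>x. x \<in> tile \<Longrightarrow> norm x \<le> B" using bounded_tile by (auto simp: bounded_iff)
      have "n \<le> nat \<lceil>(norm y + B) / norm (rvec h)\<rceil>" if "n \<in> N" for n
      proof -
        have "real n * norm (rvec h) = norm (y - (y - real n *\<^sub>R rvec h))" by simp
        also have "\<dots> \<le> norm y + B"
          using B that by (intro order.trans[OF norm_triangle_ineq4]) (auto simp: N_def)
        finally have "real n \<le> (norm y + B) / norm (rvec h)" using h by (simp add: field_simps)
        then show ?thesis by linarith
      qed
      then show ?thesis by (meson finite_nat_set_iff_bounded_le)
    qed
    moreover have "0 \<in> N" using i by (simp add: N_def y_def)
    ultimately have n: "Max N \<in> N" "Suc (Max N) \<notin> N"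
      using Max_in[of N] Max_ge[of N "Suc (Max N)"] by (blast, linarith)
    have "y - real (Max N) *\<^sub>R rvec h \<in> tile - O'"
    proof
      show "y - real (Max N) *\<^sub>R rvec h \<in> tile" using n(1) unfolding N_def by simp
      show "y - real (Max N) *\<^sub>R rvec h \<notin> O'"
      proof
        assume "y - real (Max N) *\<^sub>R rvec h \<in> O'"
        then obtain x where x: "x \<in> tile" "y - real (Max N) *\<^sub>R rvec h = rvec h + x" by (auto simp: O'_def)
        then have "y - real (Suc (Max N)) *\<^sub>R rvec h = x"
          by (simp add: algebra_simps)
        with x(1) n(2) show False by (simp add: N_def)
      qed
    qed
    moreover have "y - real (Max N) *\<^sub>R rvec h = x - rvec (i + of_nat (Max N) * h)"
      by (simp only: rvec_simps rv) (simp add: y_def)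
    ultimately show "\<exists>k. x - rvec k \<in> tile - O'" by metis
  qed (rule meas)
  moreover have "emeasure lebesgue (tile - O') + emeasure lebesgue O' = 1"
  proof -
    have "(tile - O') \<union> O' = tile" by (auto simp: O'_def)
    then show ?thesis using plus_emeasure[OF meas(2,1)] one by auto
  qed
  ultimately have "emeasure lebesgue O' = 0"
  proof -
    assume a: "1 \<le> emeasure lebesgue (tile - O')" and s: "emeasure lebesgue (tile - O') + emeasure lebesgue O' = 1"
    have "emeasure lebesgue (tile - O') = 1" using a s by (metis antisym le_iff_add)
    with s have "1 + emeasure lebesgue O' = 1 + 0" by simp
    then show ?thesis by (subst (asm) ennreal_add_left_cancel) simp
  qed
  then have "negligible O'" using meas(1) by (simp add: negligible_iff_emeasure0)
  then have "negligible ((\<lambda>x. rvec j + x) ` O')" by (rule negligible_translation)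
  moreover have "(\<lambda>x. rvec j + x) ` tile \<inter> (\<lambda>x. rvec k + x) ` tile \<subseteq> (\<lambda>x. rvec j + x) ` O'"
  proof (clarify)
    fix x y assume xy: "x \<in> tile" "rvec j + y = rvec k + x" "y \<in> tile"
    then have "y = rvec h + x" by (simp add: h_def algebra_simps)
    then show "rvec j + y \<in> (\<lambda>x. rvec j + x) ` O'" using xy by (auto simp: O'_def)
  qed
  ultimately show ?thesis by (rule negligible_subset)
qed

text \<open>
  The piece is mapped onto the tile by an invertible affine map, and such maps preserve null sets.
\<close>
lemma subtile_not_negligible:
  assumes one: "emeasure lebesgue tile = 1"
  shows "\<not> negligible ((\<lambda>x. a + place ds x) ` tile)"
proof
  define n where "n = length ds"
  define b where "b = place ds 0"
  assume "negligible ((\<lambda>x. a + place ds x) ` tile)"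
  then have "negligible ((\<lambda>x. - a - b + x) ` ((\<lambda>x. a + place ds x) ` tile))"
    by (rule negligible_translation)
  moreover have "- a - b + (a + place ds x) = (contract ^^ n) x" for x
    using place_diff[of ds x 0] by (simp add: b_def n_def)
  ultimately have "negligible ((contract ^^ n) ` tile)"
    by (simp only: image_image)
  then have "negligible ((dilate ^^ n) ` ((contract ^^ n) ` tile))"
    by (rule negligible_differentiable_image_negligible[OF order_refl])
      (intro differentiable_at_imp_differentiable_on linear_imp_differentiable linear_dilate_funpow)
  then have "negligible tile" by (simp add: image_image)
  then show False using one tile_measurable by (simp add: negligible_iff_emeasure0)
qed

lemma contract_uniformly_small:
  assumes "0 < e"
  shows "\<exists>n. \<forall>x. norm x \<le> B \<longrightarrow> norm ((contract ^^ n) x) < e"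
proof -
  obtain R C :: real where RC: "0 < R" "R < 1" "0 \<le> C" "\<forall>k x. norm ((contract ^^ k) x) \<le> C * R ^ k * norm x"
    by (rule contract_decay)
  have "(\<lambda>n. C * \<bar>B\<bar> * R ^ n) \<longlonglongrightarrow> 0"
    using RC(1-3) by (intro tendsto_mult_right_zero LIMSEQ_power_zero) simp
  then have "eventually (\<lambda>n. C * \<bar>B\<bar> * R ^ n < e) sequentially"
    using assms by (rule order_tendstoD)
  then obtain n where n: "C * \<bar>B\<bar> * R ^ n < e" by (auto simp: eventually_sequentially)
  have "norm ((contract ^^ n) x) < e" if "norm x \<le> B" for x
  proof -
    have "norm ((contract ^^ n) x) \<le> C * R ^ n * norm x" by (rule RC(4)[rule_format])
    also have "\<dots> \<le> C * R ^ n * \<bar>B\<bar>" using RC(1-3) that by (intro mult_left_mono) auto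
    finally show ?thesis using n by (simp add: mult_ac)
  qed
  then show ?thesis by blast
qed

end

section \<open>The joint spectral radius on an invariant subspace\<close>

text \<open>
  Without boundedness the supremum in the restricted norm would be an arbitrary value. At \<open>u = 0\<close> the
  quotient is \<open>0 / 0 = 0\<close>, which does no harm because the other quotients are nonnegative.
\<close>
lemma onorm_on_bdd: "bdd_above ((\<lambda>u. norm (A *v u) / norm u) ` U)"
  for A :: "real ^ 'n ^ 'n"
proof (rule bdd_aboveI2)
  fix u
  show "norm (A *v u) / norm u \<le> onorm ((*v) A)"
    using le_onorm[of "(*v) A" u] by simp
qed

lemma onorm_on_bound:
  assumes "u \<in> U"
  shows "norm (A *v u) \<le> onorm_on U A * norm u"
proof (cases "u = 0")
  case False
  have "norm (A *v u) / norm u \<le> onorm_on U A"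
    unfolding onorm_on_def by (rule cSUP_upper[OF assms onorm_on_bdd])
  with False show ?thesis by (simp add: divide_le_eq)
qed simp

lemma onorm_on_nonneg:
  assumes "0 \<in> U"
  shows "0 \<le> onorm_on U A"
proof -
  have "norm (A *v 0) / norm (0 :: real ^ 'a) \<le> onorm_on U A"
    unfolding onorm_on_def by (rule cSUP_upper[OF assms onorm_on_bdd])
  then show ?thesis by simp
qed

lemma onorm_on_least:
  assumes "0 \<in> U" "0 \<le> C" "\<And>u. u \<in> U \<Longrightarrow> norm (A *v u) \<le> C * norm u"
  shows "onorm_on U A \<le> C"
  unfolding onorm_on_def
proof (rule cSUP_least)
  show "U \<noteq> {}" using assms(1) by blast
  show "norm (A *v u) / norm u \<le> C" if "u \<in> U" for u
    using assms(3)[OF that] assms(2) by (cases "u = 0") (simp_all add: divide_le_eq)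
qed

lemma matrix_word_simps [simp]:
  "matrix_word [] = mat 1" "matrix_word (A # As) = A ** matrix_word As"
  by (simp_all add: matrix_word_def)

lemma matrix_word_append: "matrix_word (As @ Bs) = matrix_word As ** matrix_word Bs"
  by (induction As) (simp_all add: matrix_mul_assoc)

text \<open>
  Fekete's lemma in multiplicative form: the roots converge to their infimum, since \<open>m p \<le> l\<^sup>p\<close> for one
  \<open>p\<close> bounds \<open>m k\<close> by a constant times \<open>l\<^sup>k\<close>, by division of \<open>k\<close> by \<open>p\<close>.
\<close>
lemma submultiplicative_root_converges:
  fixes m :: "nat \<Rightarrow> real"
  assumes nonneg: "\<And>k. 0 \<le> m k" and submult: "\<And>j k. m (j + k) \<le> m j * m k"
  shows "convergent (\<lambda>k. root k (m k))"
proof -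
  define L where "L = (INF k\<in>{1..}. root k (m k))"
  have bdd: "bdd_below ((\<lambda>k. root k (m k)) ` {1..})"
    by (intro bdd_belowI2[of _ 0]) (simp add: nonneg)
  have lower: "L \<le> root k (m k)" if "1 \<le> k" for k
    unfolding L_def using that by (intro cINF_lower[OF bdd]) simp
  have upper: "eventually (\<lambda>k. root k (m k) < x) sequentially" if x: "L < x" for x
  proof -
    obtain l where l: "L < l" "l < x" using dense[OF x] by blast
    have "0 \<le> L" unfolding L_def by (rule cINF_greatest) (simp_all add: nonneg)
    then have "0 < l" using l by simp
    \<comment> \<open>some block length p already achieves the rate l\<close>
    obtain p where p: "1 \<le> p" "root p (m p) < l"
      using l(1) unfolding L_def by (subst (asm) cINF_less_iff[OF _ bdd]) auto
    have mp: "m p \<le> l ^ p"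
      using p nonneg[of p] by (metis less_imp_le power_mono real_root_ge_zero real_root_pow_pos2 zero_less_one_class.zero_less_one less_le_trans linorder_not_less not_one_le_zero neq0_conv)
    define C where "C = (\<Sum>s<p. m s / l ^ s)"
    have C: "m s \<le> C * l ^ s" if "s < p" for s
    proof -
      have "m s / l ^ s \<le> C" unfolding C_def
        using that nonneg \<open>0 < l\<close> by (intro member_le_sum) auto
      then show ?thesis using \<open>0 < l\<close> by (simp add: divide_le_eq)
    qed
    have C0: "0 \<le> C" unfolding C_def using nonneg \<open>0 < l\<close> by (intro sum_nonneg) auto
    have blocks: "m (q * p + s) \<le> l ^ (q * p) * m s" for q s
    proof (induction q)
      case (Suc q)
      have "m (Suc q * p + s) \<le> m p * m (q * p + s)"
        using submult[of p "q * p + s"] by (simp add: add.assoc)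
      also have "\<dots> \<le> l ^ p * (l ^ (q * p) * m s)"
        using mp Suc nonneg \<open>0 < l\<close> by (intro mult_mono) auto
      finally show ?case by (simp add: power_add mult_ac)
    qed simp
    have bound: "m k \<le> (C + 1) * l ^ k" for k
    proof -
      \<comment> \<open>full blocks of length p have rate l, and the constant C takes care of the remainder\<close>
      have k: "k = k div p * p + k mod p" by simp
      have "m k \<le> l ^ (k div p * p) * m (k mod p)" using blocks[of "k div p" "k mod p"] by simp
      also have "\<dots> \<le> l ^ (k div p * p) * (C * l ^ (k mod p))"
        using p(1) \<open>0 < l\<close> C by (intro mult_left_mono) auto
      also have "\<dots> = C * l ^ k" by (subst (3) k) (simp only: power_add mult_ac)
      also have "\<dots> \<le> (C + 1) * l ^ k" using \<open>0 < l\<close> by (simp add: algebra_simps)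
      finally show ?thesis .
    qed
    have "(\<lambda>k. root k (C + 1) * l) \<longlonglongrightarrow> 1 * l"
      using C0 by (intro tendsto_mult LIMSEQ_root_const tendsto_const) simp
    then have "eventually (\<lambda>k. root k (C + 1) * l < x) sequentially"
      using l(2) by (auto elim: order_tendstoD)
    then show ?thesis
      using eventually_ge_at_top[of 1]
    proof eventually_elim
      case (elim k)
      have "root k (m k) \<le> root k ((C + 1) * l ^ k)" using elim(2) bound by simp
      also have "\<dots> = root k (C + 1) * l"
        using elim(2) \<open>0 < l\<close> by (simp add: real_root_mult real_root_power_cancel)
      finally show ?case using elim(1) by simp
    qed
  qed
  have "(\<lambda>k. root k (m k)) \<longlonglongrightarrow> L"
  proof (rule order_tendstoI)
    fix a assume "a < L"
    then show "eventually (\<lambda>k. a < root k (m k)) sequentially"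
      using lower by (intro eventually_sequentiallyI[of 1]) (meson less_le_trans)
  qed (rule upper)
  then show ?thesis by (rule convergentI)
qed

locale invariant_matrix_family =
  fixes U :: "(real ^ 'n) set" and \<A> :: "(real ^ 'n ^ 'n) set"
  assumes subspace_U: "subspace U" and finite_family: "finite \<A>" and nonempty_family: "\<A> \<noteq> {}"
    and invariant: "\<And>A u. A \<in> \<A> \<Longrightarrow> u \<in> U \<Longrightarrow> A *v u \<in> U"
begin

definition max_norm :: "nat \<Rightarrow> real"
  where "max_norm k = Max {onorm_on U (matrix_word As) | As. set As \<subseteq> \<A> \<and> length As = k}"

abbreviation \<rho> :: real
  where "\<rho> \<equiv> joint_spectral_radius_on U \<A>"

lemma zero_in_U: "0 \<in> U" using subspace_U by (rule subspace_0)

lemma word_invariant: "set As \<subseteq> \<A> \<Longrightarrow> u \<in> U \<Longrightarrow> matrix_word As *v u \<in> U"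
  by (induction As) (auto simp: invariant simp flip: matrix_vector_mul_assoc)

lemma norms_finite: "finite {onorm_on U (matrix_word As) | As. set As \<subseteq> \<A> \<and> length As = k}"
proof -
  have "{onorm_on U (matrix_word As) | As. set As \<subseteq> \<A> \<and> length As = k}
      = (\<lambda>As. onorm_on U (matrix_word As)) ` {As. set As \<subseteq> \<A> \<and> length As = k}" by blast
  then show ?thesis using finite_lists_length_eq[OF finite_family] by simp
qed

lemma norms_nonempty: "{onorm_on U (matrix_word As) | As. set As \<subseteq> \<A> \<and> length As = k} \<noteq> {}"
proof -
  obtain A where "A \<in> \<A>" using nonempty_family by blast
  then have "set (replicate k A) \<subseteq> \<A> \<and> length (replicate k A) = k" by auto
  then show ?thesis by blast
qed

lemma max_norm_ge: "set As \<subseteq> \<A> \<Longrightarrow> onorm_on U (matrix_word As) \<le> max_norm (length As)"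
  unfolding max_norm_def by (rule Max_ge[OF norms_finite]) blast

lemma max_norm_le:
  assumes "\<And>As. set As \<subseteq> \<A> \<Longrightarrow> length As = k \<Longrightarrow> onorm_on U (matrix_word As) \<le> C"
  shows "max_norm k \<le> C"
  unfolding max_norm_def by (subst Max_le_iff[OF norms_finite norms_nonempty]) (use assms in blast)

lemma max_norm_nonneg: "0 \<le> max_norm k"
proof -
  obtain As where "set As \<subseteq> \<A>" "length As = k" using norms_nonempty by blast
  then show ?thesis using max_norm_ge[of As] onorm_on_nonneg[OF zero_in_U, of "matrix_word As"] by simp
qed

lemma word_bound:
  assumes "set As \<subseteq> \<A>" "u \<in> U"
  shows "norm (matrix_word As *v u) \<le> max_norm (length As) * norm u"
  using onorm_on_bound[OF assms(2), of "matrix_word As"] mult_right_mono[OF max_norm_ge[OF assms(1)], of "norm u"]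
  by simp

lemma max_norm_submult: "max_norm (j + k) \<le> max_norm j * max_norm k"
proof (rule max_norm_le)
  fix As assume As: "set As \<subseteq> \<A>" "length As = j + k"
  define Bs Cs where "Bs = take j As" and "Cs = drop j As"
  have BC: "As = Bs @ Cs" "set Bs \<subseteq> \<A>" "set Cs \<subseteq> \<A>" "length Bs = j" "length Cs = k"
    using As set_take_subset[of j As] set_drop_subset[of j As] by (auto simp: Bs_def Cs_def)
  show "onorm_on U (matrix_word As) \<le> max_norm j * max_norm k"
  proof (rule onorm_on_least[OF zero_in_U])
    show "0 \<le> max_norm j * max_norm k" by (simp add: max_norm_nonneg)
    fix u assume u: "u \<in> U"
    have "norm (matrix_word As *v u) = norm (matrix_word Bs *v (matrix_word Cs *v u))"
      by (simp add: BC(1) matrix_word_append matrix_vector_mul_assoc)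
    also have "\<dots> \<le> max_norm j * norm (matrix_word Cs *v u)"
      using word_bound[OF BC(2) word_invariant[OF BC(3) u]] BC(4) by simp
    also have "\<dots> \<le> max_norm j * (max_norm k * norm u)"
      using word_bound[OF BC(3) u] BC(5) max_norm_nonneg by (intro mult_left_mono) auto
    finally show "norm (matrix_word As *v u) \<le> max_norm j * max_norm k * norm u" by (simp add: mult.assoc)
  qed
qed

text \<open>
  Invariance of \<open>U\<close> makes the restricted norms submultiplicative, so the limit in the definition of the
  joint spectral radius exists.
\<close>
lemma root_max_norm_tendsto: "(\<lambda>k. root k (max_norm k)) \<longlonglongrightarrow> \<rho>"
  using submultiplicative_root_converges[OF max_norm_nonneg max_norm_submult]
  unfolding joint_spectral_radius_on_def max_norm_def[symmetric] by (simp add: convergent_LIMSEQ_iff)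

lemma joint_spectral_radius_nonneg: "0 \<le> \<rho>"
  by (rule LIMSEQ_le_const[OF root_max_norm_tendsto]) (simp add: max_norm_nonneg real_root_ge_zero)

lemma joint_spectral_radius_growth:
  assumes "\<rho> < l"
  obtains C where "0 \<le> C" "\<And>As u. set As \<subseteq> \<A> \<Longrightarrow> u \<in> U \<Longrightarrow>
    norm (matrix_word As *v u) \<le> C * l ^ length As * norm u"
proof -
  have l: "0 < l" using assms joint_spectral_radius_nonneg by simp
  have "eventually (\<lambda>k. root k (max_norm k) < l) sequentially"
    by (rule order_tendstoD(2)[OF root_max_norm_tendsto assms])
  then obtain N where N: "\<And>k. N \<le> k \<Longrightarrow> root k (max_norm k) < l"
    by (auto simp: eventually_sequentially)
  define C where "C = 1 + (\<Sum>k\<le>N. max_norm k / l ^ k)"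
  have C: "1 \<le> C" unfolding C_def using l by (simp add: sum_nonneg max_norm_nonneg)
  have bound: "max_norm k \<le> C * l ^ k" for k
  proof (cases "k \<le> N")
    case True
    then have "max_norm k / l ^ k \<le> (\<Sum>k\<le>N. max_norm k / l ^ k)"
      using l by (intro member_le_sum) (auto simp: max_norm_nonneg)
    then have "max_norm k / l ^ k \<le> C" by (simp add: C_def)
    then show ?thesis using l by (simp add: divide_le_eq)
  next
    case False
    then have k: "0 < k" "root k (max_norm k) \<le> l" using N[of k] by auto
    have "max_norm k = root k (max_norm k) ^ k" using k max_norm_nonneg by simp
    also have "\<dots> \<le> l ^ k" using k max_norm_nonneg by (intro power_mono) auto
    also have "\<dots> \<le> C * l ^ k" using C l by simp
    finally show ?thesis .
  qed
  show thesis
  proof (rule that)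
    show "0 \<le> C" using C by simp
    fix As u assume "set As \<subseteq> \<A>" "u \<in> U"
    then show "norm (matrix_word As *v u) \<le> C * l ^ length As * norm u"
      using word_bound[of As u] mult_right_mono[OF bound[of "length As"], of "norm u"] by simp
  qed
qed

lemma joint_spectral_radius_le:
  assumes "0 \<le> l" "0 \<le> C" and bound: "\<And>As u. set As \<subseteq> \<A> \<Longrightarrow> u \<in> U \<Longrightarrow>
    norm (matrix_word As *v u) \<le> C * l ^ length As * norm u"
  shows "\<rho> \<le> l"
proof -
  have "max_norm k \<le> (C + 1) * l ^ k" for k
  proof (rule max_norm_le)
    fix As assume As: "set As \<subseteq> \<A>" "length As = k"
    show "onorm_on U (matrix_word As) \<le> (C + 1) * l ^ k"
    proof (rule onorm_on_least[OF zero_in_U])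
      fix u assume "u \<in> U"
      have "norm (matrix_word As *v u) \<le> C * l ^ k * norm u" using bound[OF As(1) \<open>u \<in> U\<close>] As(2) by simp
      also have "\<dots> \<le> (C + 1) * l ^ k * norm u" using assms(1) by (intro mult_right_mono) auto
      finally show "norm (matrix_word As *v u) \<le> (C + 1) * l ^ k * norm u" .
    qed (use assms in auto)
  qed
  then have le: "root k (max_norm k) \<le> root k (C + 1) * l" if "1 \<le> k" for k
  proof -
    have "root k (max_norm k) \<le> root k ((C + 1) * l ^ k)" using that \<open>max_norm k \<le> _\<close> by simp
    also have "\<dots> = root k (C + 1) * l"
      using that assms(1) by (simp add: real_root_mult real_root_power_cancel)
    finally show ?thesis .
  qed
  have "(\<lambda>k. root k (C + 1) * l) \<longlonglongrightarrow> 1 * l"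
    using assms(2) by (intro tendsto_mult LIMSEQ_root_const tendsto_const) simp
  then have "\<rho> \<le> 1 * l"
    by (rule LIMSEQ_le[OF root_max_norm_tendsto]) (use le in blast)
  then show ?thesis by simp
qed

end

section \<open>Functions with small oscillation on a cover\<close>

text \<open>
  Comparison of Lebesgue measures.
\<close>
lemma interval_covered_length:
  fixes s :: "'i \<Rightarrow> real" and a b \<delta> :: real
  assumes F: "finite F" and \<delta>: "0 \<le> \<delta>" and cover: "{a..b} \<subseteq> (\<Union>i\<in>F. {s i - \<delta>..s i + \<delta>})"
  shows "b - a \<le> card F * (2 * \<delta>)"
proof (cases "a \<le> b")
  case True
  have "b - a = measure lborel {a..b}" using True by simp
  also have "\<dots> \<le> measure lborel (\<Union>i\<in>F. {s i - \<delta>..s i + \<delta>})"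
    using F by (intro measure_mono_fmeasurable[OF cover] fmeasurable.finite_UN) (auto simp: fmeasurable_def emeasure_lborel_Icc_eq)
  also have "\<dots> \<le> (\<Sum>i\<in>F. measure lborel {s i - \<delta>..s i + \<delta>})"
    by (rule measure_UNION_le[OF F]) simp
  also have "\<dots> = card F * (2 * \<delta>)" using \<delta> by simp
  finally show ?thesis .
next
  case False
  have "0 \<le> card F * (2 * \<delta>)" using \<delta> by simp
  with False show ?thesis by linarith
qed

text \<open>
  The image of the unit interval is connected, so it contains the whole interval between \<open>f 0\<close> and
  \<open>f 1\<close>, and it is covered by the images of the \<open>I i\<close>, each of which has diameter at most \<open>\<delta>\<close>.
\<close>
lemma increment_le_of_small_oscillation:
  fixes f :: "real \<Rightarrow> real" and \<delta> :: real
  assumes cont: "continuous_on {0..1} f" and F: "finite F" and \<delta>: "0 \<le> \<delta>"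
    and cover: "\<And>t. t \<in> {0..1} \<Longrightarrow> \<exists>i\<in>F. t \<in> I i"
    and osc: "\<And>i s t. i \<in> F \<Longrightarrow> s \<in> I i \<Longrightarrow> t \<in> I i \<Longrightarrow> \<bar>f t - f s\<bar> \<le> \<delta>"
  shows "\<bar>f 1 - f 0\<bar> \<le> card F * (2 * \<delta>)"
proof -
  \<comment> \<open>for an empty I i the value is irrelevant, since then nothing has to be covered\<close>
  define s where "s i = f (SOME t. t \<in> I i)" for i
  have sub: "f ` {0..1} \<subseteq> (\<Union>i\<in>F. {s i - \<delta>..s i + \<delta>})"
  proof clarify
    fix t :: real assume "t \<in> {0..1}"
    then obtain i where i: "i \<in> F" "t \<in> I i" using cover by blast
    have "\<bar>f t - s i\<bar> \<le> \<delta>"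
      unfolding s_def by (rule osc[OF i(1) someI[of "\<lambda>t. t \<in> I i", OF i(2)] i(2)])
    then show "f t \<in> (\<Union>i\<in>F. {s i - \<delta>..s i + \<delta>})" using i by (intro UN_I[of i]) auto
  qed
  have conn: "connected (f ` {0..1})" by (rule connected_continuous_image[OF cont]) simp
  have "f b - f a \<le> card F * (2 * \<delta>)" if "a \<in> {0..1}" "b \<in> {0..1}" for a b
    by (rule interval_covered_length[OF F \<delta>
          subset_trans[OF connected_contains_Icc[OF conn imageI[OF that(1)] imageI[OF that(2)]] sub]])
  from this[of 0 1] this[of 1 0] show ?thesis by auto
qed

section \<open>Refinable functions on the tile\<close>

locale refinable_tile = digit_system M D for M :: "int ^ 's ^ 's" and D +
  fixes c :: "int ^ 's \<Rightarrow> real" and \<phi> :: "real ^ 's \<Rightarrow> real" and \<omega> :: "'n::finite \<Rightarrow> int ^ 's"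
  assumes tile_measure: "emeasure lebesgue tile = 1"
    and finite_support: "finite (coeff_support c)"
    and inj_\<omega>: "inj \<omega>"
    and cover: "radix_set M (coeff_support c) \<subseteq> translates (range \<omega>) tile"
    and refinable: "continuous_refinable M c \<phi>"
begin

abbreviation v :: "real ^ 's \<Rightarrow> real ^ 'n"
  where "v \<equiv> shift_vector \<phi> \<omega>"

abbreviation T :: "int ^ 's \<Rightarrow> real ^ 'n ^ 'n"
  where "T \<equiv> transition_matrix M c \<omega>"

lemma continuous_\<phi>: "continuous_on UNIV \<phi>"
  and compact_support: "compact (closure {x. \<phi> x \<noteq> 0})"
  and integral_\<phi>: "(LINT x|lborel. \<phi> x) = 1"
  using refinable unfolding continuous_refinable_def by blast+

lemma bounded_support: "bounded {x. \<phi> x \<noteq> 0}"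
  using compact_imp_bounded[OF compact_support] closure_subset by (rule bounded_subset)

lemma refinement: "\<phi> x = (\<Sum>k\<in>coeff_support c. c k * \<phi> (dilate x - rvec k))"
  using refinable unfolding continuous_refinable_def dilate_def by blast

lemma bounded_\<phi>: obtains B where "0 \<le> B" "\<And>x. \<bar>\<phi> x\<bar> \<le> B"
proof -
  have "bounded (\<phi> ` closure {x. \<phi> x \<noteq> 0})"
    by (rule compact_imp_bounded[OF compact_continuous_image[OF
          continuous_on_subset[OF continuous_\<phi> subset_UNIV] compact_support]])
  then obtain B where B: "\<forall>y \<in> \<phi> ` closure {x. \<phi> x \<noteq> 0}. norm y \<le> B"
    unfolding bounded_iff by blast
  have "\<bar>\<phi> x\<bar> \<le> \<bar>B\<bar>" for x
  proof (cases "\<phi> x = 0")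
    case False
    then have "x \<in> closure {x. \<phi> x \<noteq> 0}" by (intro subsetD[OF closure_subset]) simp
    then have "norm (\<phi> x) \<le> B" by (rule bspec[OF B imageI])
    then show ?thesis by simp
  qed simp
  then show thesis by (rule that[OF abs_ge_zero])
qed

lemma support_subset: "{x. \<phi> x \<noteq> 0} \<subseteq> radix_set M (coeff_support c)"
proof (rule radix_set_coinduct[OF bounded_support])
  fix x assume "x \<in> {x. \<phi> x \<noteq> 0}"
  then have "(\<Sum>k\<in>coeff_support c. c k * \<phi> (dilate x - rvec k)) \<noteq> 0" using refinement[of x] by simp
  then obtain k where "k \<in> coeff_support c" "c k * \<phi> (dilate x - rvec k) \<noteq> 0"
    by (rule sum.not_neutral_contains_not_neutral)
  then show "\<exists>k\<in>coeff_support c. dilate x - rvec k \<in> {x. \<phi> x \<noteq> 0}" by auto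
qed

text \<open>
  If \<open>\<phi>\<close> did not vanish at a point of \<open>b + G\<close>, then a small piece of \<open>b + G\<close> near this point would lie in
  the support, hence in the union of the \<open>a + G\<close> with \<open>a \<in> \<Omega>\<close>. Each of these meets \<open>b + G\<close> in a null set,
  but the piece is not null.
\<close>
lemma \<phi>_vanishes:
  assumes g: "g \<in> tile" and b: "b \<notin> range \<omega>"
  shows "\<phi> (g + rvec b) = 0"
proof (rule ccontr)
  assume nz: "\<phi> (g + rvec b) \<noteq> 0"
  have "open {x. \<phi> x \<noteq> 0}" by (rule open_Collect_neq[OF continuous_\<phi> continuous_on_const])
  moreover have "g + rvec b \<in> {x. \<phi> x \<noteq> 0}" using nz by simp
  ultimately obtain e where e: "0 < e" "ball (g + rvec b) e \<subseteq> {x. \<phi> x \<noteq> 0}"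
    by (rule openE)
  obtain B where B: "\<And>x. x \<in> tile \<Longrightarrow> norm x \<le> B" using bounded_tile by (auto simp: bounded_iff)
  obtain n where n: "\<forall>x. norm x \<le> 2 * B \<longrightarrow> norm ((contract ^^ n) x) < e"
    using contract_uniformly_small[OF e(1), of "2 * B"] by blast
  obtain ds y where ds: "length ds = n" "set ds \<subseteq> D" "y \<in> tile" "g = place ds y"
    using tile_expansion[OF g, of n] by blast
  have "(\<lambda>x. rvec b + place ds x) ` tile
      \<subseteq> (\<Union>a\<in>range \<omega>. (\<lambda>x. rvec b + x) ` tile \<inter> (\<lambda>x. rvec a + x) ` tile)"
  proof clarify
    fix x assume x: "x \<in> tile"
    have "dist (g + rvec b) (rvec b + place ds x) = norm (place ds y - place ds x)"
      by (simp add: dist_norm ds(4))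
    also have "\<dots> = norm ((contract ^^ n) (y - x))" by (simp add: place_diff ds(1))
    also have "\<dots> < e"
      using n norm_triangle_ineq4[of y x] B[OF x] B[OF ds(3)] by auto
    finally have "rvec b + place ds x \<in> {x. \<phi> x \<noteq> 0}" using e(2) by auto
    then have "rvec b + place ds x \<in> translates (range \<omega>) tile"
      by (intro subsetD[OF cover] subsetD[OF support_subset])
    then obtain a t where at: "a \<in> range \<omega>" "t \<in> tile" "rvec b + place ds x = rvec a + t"
      unfolding translates_def by blast
    have p: "place ds x \<in> tile" by (rule place_in_tile[OF ds(2) x])
    show "rvec b + place ds x \<in> (\<Union>a\<in>range \<omega>. (\<lambda>x. rvec b + x) ` tile \<inter> (\<lambda>x. rvec a + x) ` tile)"
    proof (rule UN_I[OF at(1)], rule IntI)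
      show "rvec b + place ds x \<in> (\<lambda>x. rvec b + x) ` tile" using p by (rule imageI)
      show "rvec b + place ds x \<in> (\<lambda>x. rvec a + x) ` tile" unfolding at(3) using at(2) by (rule imageI)
    qed
  qed
  moreover have "negligible (\<Union>a\<in>range \<omega>. (\<lambda>x. rvec b + x) ` tile \<inter> (\<lambda>x. rvec a + x) ` tile)"
  proof (rule negligible_Union)
    show "finite ((\<lambda>a. (\<lambda>x. rvec b + x) ` tile \<inter> (\<lambda>x. rvec a + x) ` tile) ` range \<omega>)" by simp
    fix S assume "S \<in> (\<lambda>a. (\<lambda>x. rvec b + x) ` tile \<inter> (\<lambda>x. rvec a + x) ` tile) ` range \<omega>"
    then obtain a where a: "a \<in> range \<omega>" "S = (\<lambda>x. rvec b + x) ` tile \<inter> (\<lambda>x. rvec a + x) ` tile" by blast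
    then have "b \<noteq> a" using b by blast
    then show "negligible S" unfolding a(2) by (rule tile_overlap_negligible[OF tile_measure])
  qed
  ultimately have "negligible ((\<lambda>x. rvec b + place ds x) ` tile)" by (rule negligible_subset[rotated])
  then show False using subtile_not_negligible[OF tile_measure, of "rvec b" ds] by simp
qed

text \<open>
  The refinement equation with the summation index \<open>k\<close> replaced by \<open>M a - k + d\<close>. The terms with index
  outside \<open>\<Omega>\<close> vanish by the previous lemma.
\<close>
lemma transition:
  assumes y: "y \<in> tile" and d: "d \<in> D"
  shows "v (contract (y + rvec d)) = T d *v v y"
  unfolding vec_eq_iff
proof
  fix a
  define g where "g b = M *v \<omega> a - b + d" for b
  have gg: "g (g b) = b" for b by (simp add: g_def)
  then have inj_g: "inj_on g S" for S by (metis inj_onI)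
  define f where "f j = c (g j) * \<phi> (y + rvec j)" for j
  have "v (contract (y + rvec d)) $ a = \<phi> (contract (y + rvec d) + rvec (\<omega> a))"
    by (simp add: shift_vector_def)
  also have "\<dots> = (\<Sum>k\<in>coeff_support c. c k * \<phi> (y + rvec (g k)))"
  proof -
    have "dilate (contract (y + rvec d) + rvec (\<omega> a)) - rvec k = y + rvec (g k)" for k
      by (simp add: g_def rvec_dilate del: rvec_simps(4) contract_linear_simps)
    then show ?thesis by (subst refinement) (simp only:)
  qed
  also have "\<dots> = (\<Sum>j\<in>g ` coeff_support c. f j)"
    by (simp add: sum.reindex[OF inj_g] f_def gg)
  also have "\<dots> = (\<Sum>j\<in>range \<omega> \<union> g ` coeff_support c. f j)"
  proof (rule sum.mono_neutral_left)
    show "\<forall>j\<in>range \<omega> \<union> g ` coeff_support c - g ` coeff_support c. f j = 0"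
    proof
      fix j assume j: "j \<in> range \<omega> \<union> g ` coeff_support c - g ` coeff_support c"
      have "g j \<notin> coeff_support c"
      proof
        assume "g j \<in> coeff_support c"
        then have "g (g j) \<in> g ` coeff_support c" by (rule imageI)
        then show False using j by (simp add: gg)
      qed
      then show "f j = 0" by (simp add: f_def coeff_support_def)
    qed
  qed (use finite_support in auto)
  also have "\<dots> = (\<Sum>j\<in>range \<omega>. f j)"
    by (rule sum.mono_neutral_right) (use finite_support \<phi>_vanishes[OF y] in \<open>auto simp: f_def\<close>)
  also have "\<dots> = (\<Sum>b\<in>UNIV. f (\<omega> b))" by (simp add: sum.reindex[OF inj_\<omega>])
  also have "\<dots> = (T d *v v y) $ a"
    by (simp add: f_def g_def matrix_vector_mult_def transition_matrix_def shift_vector_def)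
  finally show "v (contract (y + rvec d)) $ a = (T d *v v y) $ a" .
qed

lemma transition_word:
  "set ds \<subseteq> D \<Longrightarrow> x \<in> tile \<Longrightarrow> v (place ds x) = matrix_word (map T ds) *v v x"
proof (induction ds)
  case (Cons d ds)
  then have "v (place (d # ds) x) = T d *v v (place ds x)"
    using transition[OF place_in_tile, of ds x d] by (simp del: contract_linear_simps)
  then show ?case using Cons by (simp add: matrix_vector_mul_assoc)
qed simp

lemma matrix_words_over_digits:
  assumes "set As \<subseteq> T ` D"
  obtains ds where "set ds \<subseteq> D" "As = map T ds"
proof -
  have "As \<in> lists (T ` D)" using assms by auto
  then obtain ds where "ds \<in> lists D" "As = map T ds" by (auto simp: lists_image)
  then show thesis using that by auto
qed

definition diff_space :: "real \<Rightarrow> (real ^ 'n) set"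
  where "diff_space r = difference_space v tile (spectral_subspace M r)"

lemma diff_space_generator:
  "x \<in> tile \<Longrightarrow> y \<in> tile \<Longrightarrow> y - x \<in> spectral_subspace M r \<Longrightarrow> v y - v x \<in> diff_space r"
  unfolding diff_space_def difference_space_def by (intro span_base) blast

lemma diff_space_minimal:
  assumes "subspace S"
    and "\<And>x y. x \<in> tile \<Longrightarrow> y \<in> tile \<Longrightarrow> y - x \<in> spectral_subspace M r \<Longrightarrow> v y - v x \<in> S"
  shows "diff_space r \<subseteq> S"
  unfolding diff_space_def difference_space_def
  by (rule span_minimal) (use assms in auto)

lemma transition_family: "invariant_matrix_family (diff_space r) (T ` D)"
proof
  show "subspace (diff_space r)" by (simp add: diff_space_def difference_space_def subspace_span)
  show "finite (T ` D)" using finite_digits by simp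
  show "T ` D \<noteq> {}" using zero_digit by blast
  fix A u assume A: "A \<in> T ` D" and u: "u \<in> diff_space r"
  from A obtain d where d: "d \<in> D" "A = T d" by blast
  have "diff_space r \<subseteq> {u. T d *v u \<in> diff_space r}"
  proof (rule diff_space_minimal)
    show "subspace {u. T d *v u \<in> diff_space r}"
      using \<open>subspace (diff_space r)\<close>
      by (auto simp: subspace_def matrix_vector_right_distrib matrix_vector_mult_scaleR)
    fix x y assume xy: "x \<in> tile" "y \<in> tile" "y - x \<in> spectral_subspace M r"
    have "T d *v (v y - v x) = v (contract (y + rvec d)) - v (contract (x + rvec d))"
      using transition d(1) xy by (simp add: matrix_vector_mult_diff_distrib del: contract_linear_simps)
    moreover have "contract (y + rvec d) - contract (x + rvec d) = contract (y - x)" by simp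
    ultimately show "v y - v x \<in> {u. T d *v u \<in> diff_space r}"
      using diff_space_generator[of "contract (x + rvec d)" "contract (y + rvec d)" r]
        radix_set_cons[OF finite_digits d(1)] spectral_contract[OF xy(3)] xy(1,2)
      by (simp del: contract_linear_simps)
  qed
  then show "A *v u \<in> diff_space r" using u d(2) by blast
qed

abbreviation jsr :: "real \<Rightarrow> real"
  where "jsr r \<equiv> joint_spectral_radius_on (diff_space r) (T ` D)"

definition holder_along :: "real \<Rightarrow> real \<Rightarrow> bool"
  where "holder_along r \<alpha> \<longleftrightarrow> (\<exists>C. \<forall>x y. y - x \<in> spectral_subspace M r \<longrightarrow>
    \<bar>\<phi> y - \<phi> x\<bar> \<le> C * norm (y - x) powr \<alpha>)"

lemma modulus_gt_1: "r \<in> eigenvalue_moduli M \<Longrightarrow> 1 < r"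
  using eigenvalue_gt_1 by (auto simp: eigenvalue_moduli_def)

text \<open>
  Words of length \<open>k\<close> carry a generator \<open>v y - v x\<close> of the difference space to a difference of values
  of \<open>v\<close> at points that differ by \<open>B\<^sup>k (y - x)\<close>, to which the Hoelder condition applies. Any rate \<open>q\<close>
  above \<open>1 / r\<close> is allowed.
\<close>
lemma jsr_le_of_holder_rate:
  assumes r: "0 < r" and \<alpha>: "0 \<le> \<alpha>" and holder: "holder_along r \<alpha>" and q: "1 / r < q"
  shows "jsr r \<le> q powr \<alpha>"
proof -
  interpret invariant_matrix_family "diff_space r" "T ` D" by (rule transition_family)
  have q0: "0 < q" using r q by (smt (verit) divide_pos_pos)
  define l where "l = q powr \<alpha>"
  have l: "0 < l" using q0 by (simp add: l_def)
  obtain C0 where C0: "\<And>x y. y - x \<in> spectral_subspace M r \<Longrightarrow>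
    \<bar>\<phi> y - \<phi> x\<bar> \<le> C0 * norm (y - x) powr \<alpha>" using holder by (auto simp: holder_along_def)
  obtain C1 where C1: "0 \<le> C1" "\<And>k x. x \<in> spectral_subspace M r \<Longrightarrow>
    norm ((contract ^^ k) x) \<le> C1 * q ^ k * norm x"
    using spectral_contract_growth[OF q r] by blast
  \<comment> \<open>words over other matrices are made trivial, so that all lists can serve as indices\<close>
  define L where "L As = (if set As \<subseteq> T ` D then (*v) (matrix_word As) else (\<lambda>_. 0))" for As
  have lin: "linear (L As)" for As by (simp add: L_def linear_zero)
  have sub: "diff_space r \<subseteq> {u. \<exists>C. \<forall>As. norm (L As u) \<le> C * l ^ length As}"
  proof (rule diff_space_minimal)
    show "subspace {u. \<exists>C. \<forall>As. norm (L As u) \<le> C * l ^ length As}"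
      using l by (intro subspace_pointwise_bounds lin) auto
    fix x y assume xy: "x \<in> tile" "y \<in> tile" "y - x \<in> spectral_subspace M r"
    define C where "C = CARD('n) * (\<bar>C0\<bar> * (C1 * norm (y - x)) powr \<alpha>)"
    have "norm (L As (v y - v x)) \<le> C * l ^ length As" for As
    proof (cases "set As \<subseteq> T ` D")
      case True
      then obtain ds where ds: "set ds \<subseteq> D" "As = map T ds" by (rule matrix_words_over_digits)
      define n where "n = length ds"
      have "L As (v y - v x) = v (place ds y) - v (place ds x)"
        using True ds xy by (simp add: L_def transition_word matrix_vector_mult_diff_distrib)
      moreover have "\<bar>(v (place ds y) - v (place ds x)) $ a\<bar> \<le> \<bar>C0\<bar> * (C1 * norm (y - x)) powr \<alpha> * l ^ n" for a
      proof -
        have diff: "(place ds y + rvec (\<omega> a)) - (place ds x + rvec (\<omega> a)) = (contract ^^ n) (y - x)"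
          using place_diff[of ds y x] by (simp add: n_def)
        have "(contract ^^ n) (y - x) \<in> spectral_subspace M r"
          using xy(3) by (induction n) (auto intro: spectral_contract)
        then have "\<bar>(v (place ds y) - v (place ds x)) $ a\<bar> \<le> C0 * norm ((contract ^^ n) (y - x)) powr \<alpha>"
          using C0[of "place ds y + rvec (\<omega> a)" "place ds x + rvec (\<omega> a)"]
          unfolding diff by (simp add: shift_vector_def)
        also have "\<dots> \<le> \<bar>C0\<bar> * ((C1 * norm (y - x)) * q ^ n) powr \<alpha>"
          using C1(2)[OF xy(3), of n] \<alpha> by (intro mult_mono powr_mono2) (auto simp: mult_ac)
        also have "((C1 * norm (y - x)) * q ^ n) powr \<alpha> = (C1 * norm (y - x)) powr \<alpha> * l ^ n"
          using q0 C1(1) by (simp add: powr_mult l_def powr_power powr_powr mult.commute flip: powr_realpow)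
        finally show ?thesis by simp
      qed
      then have "norm (v (place ds y) - v (place ds x)) \<le> (\<Sum>a\<in>(UNIV :: 'n set). \<bar>C0\<bar> * (C1 * norm (y - x)) powr \<alpha> * l ^ n)"
        by (intro order.trans[OF norm_le_l1_cart] sum_mono)
      ultimately show ?thesis using ds by (simp add: C_def n_def)
    next
      case False
      have "0 \<le> C" by (simp add: C_def)
      with False l show ?thesis by (simp add: L_def)
    qed
    then show "v y - v x \<in> {u. \<exists>C. \<forall>As. norm (L As u) \<le> C * l ^ length As}" by blast
  qed
  obtain C where C: "0 \<le> C" "\<And>As u. u \<in> diff_space r \<Longrightarrow> norm (L As u) \<le> C * l ^ length As * norm u"
    using uniform_bound_on_subspace[of L "\<lambda>As. l ^ length As" "diff_space r"] lin l sub subspace_U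
    by (auto simp: subset_eq)
  have "norm (matrix_word As *v u) \<le> C * l ^ length As * norm u" if "set As \<subseteq> T ` D" "u \<in> diff_space r" for As u
    using C(2)[OF that(2), of As] that(1) by (simp add: L_def)
  then have "jsr r \<le> l" using joint_spectral_radius_le l C(1) by simp
  then show ?thesis by (simp add: l_def)
qed

lemma jsr_le_of_holder:
  assumes r: "0 < r" and \<alpha>: "0 \<le> \<alpha>" and holder: "holder_along r \<alpha>"
  shows "jsr r \<le> r powr (- \<alpha>)"
proof -
  have "(\<lambda>n. (1 / r + inverse (real (Suc n))) powr \<alpha>) \<longlonglongrightarrow> (1 / r + 0) powr \<alpha>"
    using r by (intro tendsto_powr tendsto_add tendsto_const LIMSEQ_inverse_real_of_nat) auto
  then have "jsr r \<le> (1 / r + 0) powr \<alpha>"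
    using jsr_le_of_holder_rate[OF assms] by (intro LIMSEQ_le_const) (auto intro!: exI[of _ 0])
  also have "\<dots> = r powr (- \<alpha>)" using r by (simp add: powr_minus_divide powr_divide)
  finally show ?thesis .
qed

end

section \<open>The Hoelder exponent along a spectral subspace\<close>

context refinable_tile
begin

text \<open>
  After \<open>k\<close> contractions a translate of the tile lies inside some translate \<open>j + G\<close>. If \<open>j \<in> \<Omega>\<close>, the
  values of \<open>\<phi>\<close> are a component of \<open>v\<close>, and the difference is a word of length \<open>k\<close> applied to an element
  of the difference space; otherwise \<open>\<phi>\<close> vanishes there.
\<close>
lemma refined_tile_oscillation:
  assumes "jsr r < l"
  obtains C where "0 \<le> C" "\<And>k n x y. x \<in> tile \<Longrightarrow> y \<in> tile \<Longrightarrow> y - x \<in> spectral_subspace M r \<Longrightarrow>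
    \<bar>\<phi> ((contract ^^ k) (rvec n + y)) - \<phi> ((contract ^^ k) (rvec n + x))\<bar> \<le> C * l ^ k"
proof -
  interpret invariant_matrix_family "diff_space r" "T ` D" by (rule transition_family)
  have l: "0 < l" using assms joint_spectral_radius_nonneg by simp
  obtain C where C: "0 \<le> C" "\<And>As u. set As \<subseteq> T ` D \<Longrightarrow> u \<in> diff_space r \<Longrightarrow>
    norm (matrix_word As *v u) \<le> C * l ^ length As * norm u"
    using joint_spectral_radius_growth[OF assms] by blast
  obtain B where B: "0 \<le> B" "\<And>x. \<bar>\<phi> x\<bar> \<le> B" using bounded_\<phi> by blast
  define V where "V = (\<Sum>a\<in>(UNIV :: 'n set). 2 * B)"
  have V: "norm (v y - v x) \<le> V" for x y
  proof -
    have "norm (v y - v x) \<le> (\<Sum>a\<in>UNIV. \<bar>(v y - v x) $ a\<bar>)" by (rule norm_le_l1_cart)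
    also have "\<dots> \<le> V" unfolding V_def
    proof (rule sum_mono)
      fix a
      show "\<bar>(v y - v x) $ a\<bar> \<le> 2 * B"
        using B(2)[of "y + rvec (\<omega> a)"] B(2)[of "x + rvec (\<omega> a)"] by (simp add: shift_vector_def)
    qed
    finally show ?thesis .
  qed
  have "0 \<le> V" unfolding V_def using B(1) by (simp add: sum_nonneg)
  show thesis
  proof (rule that)
    show "0 \<le> C * V" using C(1) \<open>0 \<le> V\<close> by simp
    fix k n x y assume xy: "x \<in> tile" "y \<in> tile" "y - x \<in> spectral_subspace M r"
    obtain ds j where ds: "length ds = k" "set ds \<subseteq> D"
      "\<And>x. (contract ^^ k) (rvec n + x) = rvec j + place ds x"
      using contract_lattice_shift[of k n] by auto
    show "\<bar>\<phi> ((contract ^^ k) (rvec n + y)) - \<phi> ((contract ^^ k) (rvec n + x))\<bar> \<le> C * V * l ^ k"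
    proof (cases "j \<in> range \<omega>")
      case True
      then obtain a where a: "j = \<omega> a" by auto
      have "\<bar>\<phi> ((contract ^^ k) (rvec n + y)) - \<phi> ((contract ^^ k) (rvec n + x))\<bar>
          = \<bar>(v (place ds y) - v (place ds x)) $ a\<bar>"
        unfolding ds(3) by (simp add: shift_vector_def a add.commute)
      also have "\<dots> \<le> norm (v (place ds y) - v (place ds x))" by (rule component_le_norm_cart)
      also have "v (place ds y) - v (place ds x) = matrix_word (map T ds) *v (v y - v x)"
        by (simp add: transition_word[OF ds(2)] xy matrix_vector_mult_diff_distrib)
      also have "norm \<dots> \<le> C * l ^ length (map T ds) * norm (v y - v x)"
        using ds(2) by (intro C(2) diff_space_generator xy) auto
      also have "\<dots> \<le> C * l ^ k * V"
        using V C(1) l ds(1) by (simp add: mult_left_mono)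
      finally show ?thesis by (simp add: mult_ac)
    next
      case False
      have "\<phi> (rvec j + place ds z) = 0" if "z \<in> tile" for z
        using \<phi>_vanishes[OF place_in_tile[OF ds(2) that] False] by (simp add: add.commute)
      then show ?thesis
        unfolding ds(3) using xy C(1) l \<open>0 \<le> V\<close> by simp
    qed
  qed
qed

text \<open>
  The segment from \<open>M\<^sup>k x\<close> to \<open>M\<^sup>k y\<close> has length at most 1 and meets a number of tiles that does not
  depend on \<open>k\<close>, \<open>x\<close> and \<open>y\<close>; on the part of the segment inside each of them \<open>\<phi>\<close> oscillates by
  \<open>O(l\<^sup>k)\<close>. All points of the segment differ by elements of \<open>J\<close>.
\<close>
lemma dilated_increment_bound:
  assumes "jsr r < l"
  obtains C where "0 \<le> C" "\<And>k x y. y - x \<in> spectral_subspace M r \<Longrightarrow> norm ((dilate ^^ k) (y - x)) \<le> 1 \<Longrightarrow>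
    \<bar>\<phi> y - \<phi> x\<bar> \<le> C * l ^ k"
proof -
  interpret invariant_matrix_family "diff_space r" "T ` D" by (rule transition_family)
  have l: "0 < l" using assms joint_spectral_radius_nonneg by simp
  obtain C where C: "0 \<le> C" "\<And>k n x y. x \<in> tile \<Longrightarrow> y \<in> tile \<Longrightarrow> y - x \<in> spectral_subspace M r \<Longrightarrow>
    \<bar>\<phi> ((contract ^^ k) (rvec n + y)) - \<phi> ((contract ^^ k) (rvec n + x))\<bar> \<le> C * l ^ k"
    using refined_tile_oscillation[OF assms] by metis
  obtain B where B: "\<forall>x\<in>tile. norm x \<le> B" using bounded_tile unfolding bounded_iff by blast
  obtain N where N: "\<And>z. card {n :: int ^ 's. z - rvec n \<in> cball 0 (B + 1)} \<le> N"
    "\<And>z. finite {n :: int ^ 's. z - rvec n \<in> cball 0 (B + 1)}"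
    using uniform_lattice_point_count[OF bounded_cball[of 0 "B + 1"]] by blast
  show thesis
  proof (rule that)
    show "0 \<le> real N * (2 * C)" using C(1) by simp
    fix k x y assume xy: "y - x \<in> spectral_subspace M r" "norm ((dilate ^^ k) (y - x)) \<le> 1"
    define X h where "X = (dilate ^^ k) x" and "h = (dilate ^^ k) (y - x)"
    have h: "norm h \<le> 1" "h \<in> spectral_subspace M r"
      using xy spectral_dilate_funpow by (auto simp: h_def)
    define f where "f t = \<phi> ((contract ^^ k) (X + t *\<^sub>R h))" for t
    have f_eq: "f t = \<phi> (x + t *\<^sub>R (y - x))" for t
      by (simp add: f_def X_def h_def linear_add[OF linear_contract_funpow] linear_cmul[OF linear_contract_funpow])
    \<comment> \<open>the tiles that can meet the segment: the tile lies in the ball of radius B, and the segment has length at most 1\<close>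
    define F where "F = {n :: int ^ 's. X - rvec n \<in> cball 0 (B + 1)}"
    define I where "I n = {t :: real. t \<in> {0..1} \<and> X + t *\<^sub>R h - rvec n \<in> tile}" for n
    have "\<bar>f 1 - f 0\<bar> \<le> card F * (2 * (C * l ^ k))"
    proof (rule increment_le_of_small_oscillation)
      show "continuous_on {0..1} f"
        unfolding f_eq[abs_def]
        by (rule continuous_on_compose2[OF continuous_\<phi>]) (auto intro!: continuous_intros)
      show "finite F" unfolding F_def by (rule N(2))
      show "0 \<le> C * l ^ k" using C(1) l by simp
      fix t :: real assume t: "t \<in> {0..1}"
      obtain n where n: "X + t *\<^sub>R h - rvec n \<in> tile" using tile_translates_cover[of "X + t *\<^sub>R h"] by auto
      have "norm (X - rvec n) = norm ((X + t *\<^sub>R h - rvec n) - t *\<^sub>R h)" by (simp add: algebra_simps)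
      also have "\<dots> \<le> norm (X + t *\<^sub>R h - rvec n) + norm (t *\<^sub>R h)" by (rule norm_triangle_ineq4)
      also have "\<dots> \<le> B + 1"
      proof (rule add_mono)
        show "norm (X + t *\<^sub>R h - rvec n) \<le> B" using B n by simp
        show "norm (t *\<^sub>R h) \<le> 1" using t h(1) mult_mono[of t 1 "norm h" 1] by simp
      qed
      finally have "n \<in> F" by (simp add: F_def)
      then show "\<exists>n\<in>F. t \<in> I n" using n t by (auto simp: I_def)
    next
      fix n s t assume st: "s \<in> I n" "t \<in> I n"
      define a b where "a = X + s *\<^sub>R h - rvec n" and "b = X + t *\<^sub>R h - rvec n"
      have ab: "a \<in> tile" "b \<in> tile" using st by (simp_all add: I_def a_def b_def)
      have "b - a = (t - s) *\<^sub>R h" by (simp add: a_def b_def algebra_simps)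
      then have "b - a \<in> spectral_subspace M r"
        using h(2) subspace_spectral by (simp add: subspace_scale)
      then have "\<bar>\<phi> ((contract ^^ k) (rvec n + b)) - \<phi> ((contract ^^ k) (rvec n + a))\<bar> \<le> C * l ^ k"
        by (rule C(2)[OF ab])
      moreover have "rvec n + b = X + t *\<^sub>R h" "rvec n + a = X + s *\<^sub>R h" by (simp_all add: a_def b_def)
      ultimately show "\<bar>f t - f s\<bar> \<le> C * l ^ k" by (simp add: f_def)
    qed
    also have "\<dots> \<le> real N * (2 * (C * l ^ k))"
      using N(1)[of X] C(1) l by (intro mult_right_mono) (auto simp: F_def)
    finally have "\<bar>f 1 - f 0\<bar> \<le> real N * (2 * (C * l ^ k))" .
    moreover have "f 1 = \<phi> y" "f 0 = \<phi> x" by (simp_all add: f_eq)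
    ultimately show "\<bar>\<phi> y - \<phi> x\<bar> \<le> real N * (2 * C) * l ^ k" by (simp add: mult_ac)
  qed
qed

text \<open>
  Apply the previous estimate with the last \<open>k\<close> before the norm of \<open>M\<^sup>k (y - x)\<close> exceeds 1 for the
  first time. One more dilation does exceed 1, so \<open>y - x\<close> is at least a constant times \<open>q\<^sup>-\<^sup>k\<close>.
\<close>
lemma holder_of_jsr_less:
  assumes r: "0 \<le> r" "r < q" and \<alpha>: "0 < \<alpha>" and less: "jsr r < q powr (- \<alpha>)"
  shows "holder_along r \<alpha>"
proof -
  have q: "0 < q" using r by simp
  define l where "l = q powr (- \<alpha>)"
  have l: "0 < l" "l * q powr \<alpha> = 1" using q by (simp_all add: l_def powr_minus)
  obtain C where C: "0 \<le> C" "\<And>k x y. y - x \<in> spectral_subspace M r \<Longrightarrow> norm ((dilate ^^ k) (y - x)) \<le> 1 \<Longrightarrow>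
    \<bar>\<phi> y - \<phi> x\<bar> \<le> C * l ^ k"
    using dilated_increment_bound[OF less] unfolding l_def by metis
  obtain G where G: "0 \<le> G" "\<And>k x. x \<in> spectral_subspace M r \<Longrightarrow> norm ((dilate ^^ k) x) \<le> G * q ^ k * norm x"
    using spectral_dilate_growth[OF r(2,1)] by blast
  obtain B where B: "0 \<le> B" "\<And>x. \<bar>\<phi> x\<bar> \<le> B" using bounded_\<phi> by blast
  define A where "A = 2 * B + C * (G powr \<alpha> * q powr \<alpha>)"
  have "\<bar>\<phi> y - \<phi> x\<bar> \<le> A * norm (y - x) powr \<alpha>" if J: "y - x \<in> spectral_subspace M r" for x y
  proof (cases "y = x")
    case False
    define h where "h = y - x"
    have h0: "0 < norm h" using False by (simp add: h_def)
    have "\<exists>k. 1 < norm ((dilate ^^ k) h)"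
    proof (rule ccontr)
      assume "\<nexists>k. 1 < norm ((dilate ^^ k) h)"
      then have le: "norm ((dilate ^^ k) h) \<le> 1" for k by (meson not_le)
      obtain n where "\<forall>x. norm x \<le> 1 \<longrightarrow> norm ((contract ^^ n) x) < norm h"
        using contract_uniformly_small[OF h0, of 1] by blast
      then have "norm ((contract ^^ n) ((dilate ^^ n) h)) < norm h" using le by blast
      then show False by simp
    qed
    then have ex: "\<exists>k. 1 < norm ((dilate ^^ k) h)" .
    define k where "k = (LEAST k. 1 < norm ((dilate ^^ k) h))"
    have k: "1 < norm ((dilate ^^ k) h)" unfolding k_def by (rule LeastI_ex[OF ex])
    have less_k: "norm ((dilate ^^ j) h) \<le> 1" if "j < k" for j
      using not_less_Least[OF that[unfolded k_def]] by simp
    show ?thesis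
    proof (cases k)
      case 0
      then have "1 \<le> norm h powr \<alpha>" using k \<alpha> by (simp add: ge_one_powr_ge_zero)
      moreover have "\<bar>\<phi> y - \<phi> x\<bar> \<le> 2 * B" using B(2)[of x] B(2)[of y] by linarith
      moreover have "2 * B \<le> A" using C(1) by (simp add: A_def)
      moreover have "A * 1 \<le> A * norm h powr \<alpha>"
        using \<open>1 \<le> norm h powr \<alpha>\<close> \<open>2 * B \<le> A\<close> B(1) by (intro mult_left_mono) auto
      ultimately show ?thesis unfolding h_def by linarith
    next
      case (Suc j)
      have "1 \<le> G * q ^ Suc j * norm h"
        using k G(2)[of h "Suc j"] J unfolding Suc h_def by linarith
      then have "1 \<le> (G * q ^ Suc j * norm h) powr \<alpha>" using \<alpha> by (simp add: ge_one_powr_ge_zero)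
      also have "\<dots> = G powr \<alpha> * (q powr \<alpha>) ^ Suc j * norm h powr \<alpha>"
      proof -
        have "(q ^ Suc j) powr \<alpha> = (q powr \<alpha>) ^ Suc j"
          using q by (simp add: powr_power powr_powr mult.commute flip: powr_realpow del: power_Suc)
        then show ?thesis using G(1) q by (simp add: powr_mult del: power_Suc)
      qed
      finally have "l ^ j * 1 \<le> l ^ j * (G powr \<alpha> * (q powr \<alpha>) ^ Suc j * norm h powr \<alpha>)"
        using l(1) by (intro mult_left_mono) auto
      also have "\<dots> = (l * q powr \<alpha>) ^ j * (G powr \<alpha> * q powr \<alpha> * norm h powr \<alpha>)"
        by (simp add: power_mult_distrib mult_ac)
      finally have lj: "l ^ j \<le> G powr \<alpha> * q powr \<alpha> * norm h powr \<alpha>" by (simp add: l(2))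
      have "\<bar>\<phi> y - \<phi> x\<bar> \<le> C * l ^ j"
        using C(2)[OF J, of j] less_k[of j] Suc by (simp add: h_def)
      also have "\<dots> \<le> C * (G powr \<alpha> * q powr \<alpha> * norm h powr \<alpha>)"
        using lj C(1) by (rule mult_left_mono)
      also have "\<dots> = C * (G powr \<alpha> * q powr \<alpha>) * norm h powr \<alpha>" by simp
      also have "\<dots> \<le> A * norm h powr \<alpha>" unfolding A_def using B(1) by (intro mult_right_mono) auto
      finally show ?thesis by (simp add: h_def)
    qed
  qed simp
  then show ?thesis unfolding holder_along_def by blast
qed

text \<open>
  Dividing a segment into \<open>n\<close> parts shows that a function with exponent 2 is constant along the
  direction; compact support then forces it to vanish.
\<close>
lemma not_holder_2:
  assumes "r \<in> eigenvalue_moduli M"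
  shows "\<not> holder_along r 2"
proof
  assume "holder_along r 2"
  then obtain C where C: "\<And>x y. y - x \<in> spectral_subspace M r \<Longrightarrow> \<bar>\<phi> y - \<phi> x\<bar> \<le> C * norm (y - x) powr 2"
    unfolding holder_along_def by auto
  obtain h where h: "h \<in> spectral_subspace M r" "h \<noteq> 0" using spectral_nontrivial[OF assms] by blast
  have const: "\<phi> (x + u) = \<phi> x" if u: "u \<in> spectral_subspace M r" for x u
  proof -
    have bound: "\<bar>\<phi> (x + u) - \<phi> x\<bar> \<le> C * (norm u)\<^sup>2 * inverse (real (Suc n))" for n
    proof -
      define p where "p i = \<phi> (x + (real i / real (Suc n)) *\<^sub>R u)" for i
      have step: "\<bar>p (Suc i) - p i\<bar> \<le> C * (norm u / real (Suc n))\<^sup>2" for i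
      proof -
        have d: "(x + (real (Suc i) / real (Suc n)) *\<^sub>R u) - (x + (real i / real (Suc n)) *\<^sub>R u)
            = (1 / real (Suc n)) *\<^sub>R u"
          by (simp add: add_divide_distrib scaleR_add_left del: of_nat_Suc) (simp add: add_divide_distrib scaleR_add_left)
        have "(1 / real (Suc n)) *\<^sub>R u \<in> spectral_subspace M r"
          using u by (rule subspace_scale[OF subspace_spectral])
        then have "\<bar>p (Suc i) - p i\<bar> \<le> C * norm ((1 / real (Suc n)) *\<^sub>R u) powr 2"
          using C[of "x + (real (Suc i) / real (Suc n)) *\<^sub>R u" "x + (real i / real (Suc n)) *\<^sub>R u"]
          unfolding d p_def by blast
        then show ?thesis by (simp add: powr_numeral)
      qed
      have "\<phi> (x + u) - \<phi> x = (\<Sum>i<Suc n. p (Suc i) - p i)"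
        unfolding sum_lessThan_telescope by (simp add: p_def)
      then have "\<bar>\<phi> (x + u) - \<phi> x\<bar> \<le> (\<Sum>i<Suc n. \<bar>p (Suc i) - p i\<bar>)" by (simp only: sum_abs)
      also have "\<dots> \<le> (\<Sum>i<Suc n. C * (norm u / real (Suc n))\<^sup>2)" by (rule sum_mono) (rule step)
      also have "\<dots> = real (Suc n) * (C * (norm u / real (Suc n))\<^sup>2)" by simp
      also have "\<dots> = C * (norm u)\<^sup>2 * inverse (real (Suc n))"
        by (simp add: power2_eq_square divide_inverse mult_ac del: of_nat_Suc)
      finally show ?thesis .
    qed
    have "(\<lambda>n. C * (norm u)\<^sup>2 * inverse (real (Suc n))) \<longlonglongrightarrow> C * (norm u)\<^sup>2 * 0"
      by (intro tendsto_mult tendsto_const LIMSEQ_inverse_real_of_nat)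
    then have "\<bar>\<phi> (x + u) - \<phi> x\<bar> \<le> C * (norm u)\<^sup>2 * 0"
      using bound by (intro LIMSEQ_le_const) auto
    then show ?thesis by simp
  qed
  obtain R where R: "\<forall>x\<in>{x. \<phi> x \<noteq> 0}. norm x \<le> R" using bounded_support unfolding bounded_iff by blast
  have "\<phi> x = 0" for x
  proof (rule ccontr)
    assume x: "\<phi> x \<noteq> 0"
    define t where "t = (\<bar>R\<bar> + norm x + 1) / norm h"
    have "\<phi> (x + t *\<^sub>R h) \<noteq> 0"
      using x const[OF subspace_scale[OF subspace_spectral h(1)]] by simp
    then have "norm (x + t *\<^sub>R h) \<le> R" using R by simp
    moreover have "norm (t *\<^sub>R h) = \<bar>R\<bar> + norm x + 1" using h(2) by (simp add: t_def)
    moreover have "norm (t *\<^sub>R h) \<le> norm (x + t *\<^sub>R h) + norm x"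
      using norm_triangle_ineq4[of "x + t *\<^sub>R h" x] by simp
    ultimately show False by linarith
  qed
  then have "(LINT x|lborel. \<phi> x) = 0" by simp
  then show False using integral_\<phi> by simp
qed

lemma jsr_pos:
  assumes "r \<in> eigenvalue_moduli M"
  shows "0 < jsr r"
proof (rule ccontr)
  assume "\<not> 0 < jsr r"
  moreover have "0 < (r + 1) powr (- 2)" using modulus_gt_1[OF assms] by simp
  ultimately have "jsr r < (r + 1) powr (- 2)" by linarith
  then have "holder_along r 2"
    using modulus_gt_1[OF assms] by (intro holder_of_jsr_less[of r "r + 1"]) auto
  then show False using not_holder_2[OF assms] by simp
qed

text \<open>
  Boundedness of \<open>\<phi>\<close>; for \<open>x = y\<close> the power \<open>0 powr 0\<close> is 0, but so is the increment.
\<close>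
lemma holder_0: "holder_along r 0"
proof -
  obtain B where B: "0 \<le> B" "\<And>x. \<bar>\<phi> x\<bar> \<le> B" using bounded_\<phi> by blast
  have "\<bar>\<phi> y - \<phi> x\<bar> \<le> 2 * B * norm (y - x) powr 0" for x y
    using B(2)[of x] B(2)[of y] by (cases "y = x") auto
  then show ?thesis unfolding holder_along_def by blast
qed

theorem holder_exponent_eq:
  assumes r: "r \<in> eigenvalue_moduli M"
  shows "holder_exponent \<phi> (spectral_subspace M r) = ereal (log (1 / r) (jsr r))"
proof -
  define \<beta> where "\<beta> = log (1 / r) (jsr r)"
  have r1: "1 < r" by (rule modulus_gt_1[OF r])
  have \<beta>: "\<beta> = - (ln (jsr r) / ln r)" using r1 by (simp add: \<beta>_def log_def ln_div)
  have jsr: "jsr r = r powr (- \<beta>)" using r1 jsr_pos[OF r] by (simp add: \<beta> powr_def)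
  have upper: "\<alpha> \<le> \<beta>" if "0 \<le> \<alpha>" "holder_along r \<alpha>" for \<alpha>
    using jsr_le_of_holder[OF _ that] r1 unfolding jsr by simp
  have lower: "holder_along r \<alpha>" if \<alpha>: "0 < \<alpha>" "\<alpha> < \<beta>" for \<alpha>
  proof -
    \<comment> \<open>room between the exponents leaves room for a rate q above r\<close>
    define \<gamma> where "\<gamma> = (\<alpha> + \<beta>) / 2"
    have \<gamma>: "\<alpha> < \<gamma>" "\<gamma> < \<beta>" using \<alpha> by (simp_all add: \<gamma>_def)
    show ?thesis
    proof (rule holder_of_jsr_less[of r "r powr (\<gamma> / \<alpha>)"])
      have "r powr 1 < r powr (\<gamma> / \<alpha>)" using r1 \<alpha> \<gamma> by (intro powr_less_mono) simp_all
      then show "r < r powr (\<gamma> / \<alpha>)" using r1 by simp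
      have "(r powr (\<gamma> / \<alpha>)) powr (- \<alpha>) = r powr (- \<gamma>)" using \<alpha> by (simp add: powr_powr)
      then show "jsr r < (r powr (\<gamma> / \<alpha>)) powr (- \<alpha>)" using r1 \<gamma> unfolding jsr by simp
    qed (use r1 \<alpha> in auto)
  qed
  have "holder_exponent \<phi> (spectral_subspace M r) = (SUP \<alpha>\<in>{\<alpha>. 0 \<le> \<alpha> \<and> holder_along r \<alpha>}. ereal \<alpha>)"
    by (simp add: holder_exponent_def holder_along_def)
  also have "\<dots> = ereal \<beta>"
  proof (rule antisym)
    show "(SUP \<alpha>\<in>{\<alpha>. 0 \<le> \<alpha> \<and> holder_along r \<alpha>}. ereal \<alpha>) \<le> ereal \<beta>"
      using upper by (intro SUP_least) auto
    show "ereal \<beta> \<le> (SUP \<alpha>\<in>{\<alpha>. 0 \<le> \<alpha> \<and> holder_along r \<alpha>}. ereal \<alpha>)"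
    proof (rule dense_le)
      fix x assume x: "x < ereal \<beta>"
      obtain \<alpha> where \<alpha>: "x \<le> ereal \<alpha>" "0 \<le> \<alpha>" "holder_along r \<alpha>"
      proof (cases x)
        case (real a)
        show thesis
        proof (cases "0 < a")
          case True
          then show thesis using that[of a] lower[of a] x real by simp
        next
          case False
          then show thesis using that[of 0] holder_0 real by simp
        qed
      next
        case PInf
        then show thesis using x by simp
      next
        case MInf
        then show thesis using that[of 0] holder_0 by simp
      qed
      then show "x \<le> (SUP \<alpha>\<in>{\<alpha>. 0 \<le> \<alpha> \<and> holder_along r \<alpha>}. ereal \<alpha>)"
        by (intro SUP_upper2[of \<alpha>]) auto
    qed
  qed
  finally show ?thesis by (simp add: \<beta>_def)
qed

end

theorem theorem2:
  fixes M :: "int ^ 's ^ 's"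
    and D :: "(int ^ 's) set"
    and c :: "int ^ 's \<Rightarrow> real"
    and \<phi> :: "real ^ 's \<Rightarrow> real"
    and \<omega> :: "'n::finite \<Rightarrow> int ^ 's"
    and G K :: "(real ^ 's) set"
    and r :: real
  assumes "expansive M"
    and "\<bar>det M\<bar> \<ge> 2"
    and "complete_digit_set M D"
    and "0 \<in> D"
    and "G = radix_set M D"
    and "emeasure lebesgue G = 1"
    and "finite (coeff_support c)"
    and "sum_rules M D c"
    and "K = radix_set M (coeff_support c)"
    and "inj \<omega>"
    and "minimal_cover K G (range \<omega>)"
    and "continuous_refinable M c \<phi>"
    and "r \<in> eigenvalue_moduli M"
  shows "holder_exponent \<phi> (spectral_subspace M r) =
    ereal (log (1 / r)
      (joint_spectral_radius_on
        (difference_space (shift_vector \<phi> \<omega>) G (spectral_subspace M r))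
        (transition_matrix M c \<omega> ` D)))"
proof -
  interpret refinable_tile M D c \<phi> \<omega>
    by unfold_locales (use assms in \<open>simp_all add: minimal_cover_def\<close>)
  show ?thesis
    using holder_exponent_eq[OF assms(13)] by (simp only: diff_space_def assms(5))
qed

end
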